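(* Let $T$ be chosen uniformly at random from the set of all labelled oriented trees on $n$ vertices (that is, oriented trees with vertex set $\{1,\dots,n\}$). Then asymptotically almost surely (that is, with probability tending to $1$ as $n\to\infty$) $T$ is $\frac{1}{250}$-nice.
   Context: An oriented tree is an orientation of an (undirected) tree. A leaf is a vertex of degree one. An out-leaf (respectively in-leaf) of an oriented tree $T$ is a leaf $v$ of $T$ whose unique incident edge is directed towards $v$ (respectively away from $v$). A star is a tree in which at most one vertex is not a leaf; an oriented star is an orientation of a star. A subtree $T'$ of $T$ is pendant if $T-T'$ (the subgraph induced by $V(T)\setminus V(T')$) is connected. For $\alpha>0$, an oriented tree $T$ on $n$ vertices is $\alpha$-nice if, writing $s:=\lceil\alpha n\rceil$, $T$ contains $2s$ vertex-disjoint pendant oriented stars $A_1,\dots,A_s$ and $B_1,\dots,B_s$ such that for each $i\in\{1,\dots,s\}$: (i) $A_i$ is a subtree of $T$ which contains an out-leaf of $T$, and the edge between $A_i$ and $T-A_i$ is oriented away from $A_i$; and (ii) $B_i$ is a subtree of $T$ which contains both an in-leaf of $T$ and an out-leaf of $T$, and the edge between $B_i$ and $T-B_i$ is oriented towards $B_i$. *)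

theory Defs
  imports
    "HOL-Probability.Probability_Mass_Function"
    "Graph_Theory.Graph_Theory"
begin

text \<open>
  An orientation of a finite tree, as a digraph whose arcs are ordered pairs. The underlying
  undirected graph is represented by \<^const>\<open>mk_symmetric\<close>, which contains both directions of
  every arc; every edge thus yields a directed 2-cycle there, and the undirected cycles are the
  cycles of length at least 3. (\<^const>\<open>Digraph_Component.tree\<close> is not suitable, because it only
  excludes directed cycles.) \<^const>\<open>Digraph_Component.connected\<close> is weak connectedness and
  requires a nonempty vertex set.
\<close>

definition oriented_tree :: "'a pair_pre_digraph \<Rightarrow> bool" where
  "oriented_tree T \<longleftrightarrow>
     pair_digraph T \<and>
     (\<forall>u v. (u, v) \<in> parcs T \<longrightarrow> (v, u) \<notin> parcs T) \<and>
     Digraph_Component.connected (with_proj T) \<and>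
     (\<nexists>p. pre_digraph.cycle (with_proj (mk_symmetric (with_proj T))) p \<and> length p \<ge> 3)"

text \<open>
  As an oriented tree has no pair of opposite arcs, the degree of a vertex in the underlying tree
  is the sum of its in-degree and its out-degree.
\<close>

definition leaf :: "'a pair_pre_digraph \<Rightarrow> 'a \<Rightarrow> bool" where
  "leaf T v \<longleftrightarrow>
     v \<in> pverts T \<and> in_degree (with_proj T) v + out_degree (with_proj T) v = 1"

definition out_leaf :: "'a pair_pre_digraph \<Rightarrow> 'a \<Rightarrow> bool" where
  "out_leaf T v \<longleftrightarrow> leaf T v \<and> (\<exists>u. (u, v) \<in> parcs T)"

definition in_leaf :: "'a pair_pre_digraph \<Rightarrow> 'a \<Rightarrow> bool" where
  "in_leaf T v \<longleftrightarrow> leaf T v \<and> (\<exists>u. (v, u) \<in> parcs T)"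

definition oriented_star :: "'a pair_pre_digraph \<Rightarrow> bool" where
  "oriented_star S \<longleftrightarrow> oriented_tree S \<and> card {v \<in> pverts S. \<not> leaf S v} \<le> 1"

definition subtree :: "'a pair_pre_digraph \<Rightarrow> 'a pair_pre_digraph \<Rightarrow> bool" where
  "subtree S T \<longleftrightarrow> oriented_tree S \<and> subgraph (with_proj S) (with_proj T)"

definition pendant :: "'a pair_pre_digraph \<Rightarrow> 'a pair_pre_digraph \<Rightarrow> bool" where
  "pendant S T \<longleftrightarrow>
     subtree S T \<and> Digraph_Component.connected (with_proj T \<restriction> (pverts T - pverts S))"

text \<open>
  For a pendant subtree \<open>S\<close> of an oriented tree \<open>T\<close> there is exactly one edge between \<open>S\<close> and
  \<open>T - S\<close>, so its direction is determined by the existence of an arc of that direction.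
\<close>

definition joined_away :: "'a pair_pre_digraph \<Rightarrow> 'a pair_pre_digraph \<Rightarrow> bool" where
  "joined_away S T \<longleftrightarrow> (\<exists>u \<in> pverts S. \<exists>v \<in> pverts T - pverts S. (u, v) \<in> parcs T)"

definition joined_towards :: "'a pair_pre_digraph \<Rightarrow> 'a pair_pre_digraph \<Rightarrow> bool" where
  "joined_towards S T \<longleftrightarrow> (\<exists>u \<in> pverts S. \<exists>v \<in> pverts T - pverts S. (v, u) \<in> parcs T)"

definition nice :: "real \<Rightarrow> 'a pair_pre_digraph \<Rightarrow> bool" where
  "nice \<alpha> T \<longleftrightarrow>
     oriented_tree T \<and>
     (let s = nat \<lceil>\<alpha> * real (card (pverts T))\<rceil> in
      \<exists>A B :: nat \<Rightarrow> 'a pair_pre_digraph.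
        disjoint_family_on (\<lambda>i. pverts (A i)) {1..s} \<and>
        disjoint_family_on (\<lambda>i. pverts (B i)) {1..s} \<and>
        (\<forall>i\<in>{1..s}. \<forall>j\<in>{1..s}. pverts (A i) \<inter> pverts (B j) = {}) \<and>
        (\<forall>i\<in>{1..s}.
           pendant (A i) T \<and> oriented_star (A i) \<and>
           (\<exists>v \<in> pverts (A i). out_leaf T v) \<and>
           joined_away (A i) T) \<and>
        (\<forall>i\<in>{1..s}.
           pendant (B i) T \<and> oriented_star (B i) \<and>
           (\<exists>v \<in> pverts (B i). in_leaf T v) \<and>
           (\<exists>v \<in> pverts (B i). out_leaf T v) \<and>
           joined_towards (B i) T))"

definition labelled_oriented_trees :: "nat \<Rightarrow> nat pair_pre_digraph set" where
  "labelled_oriented_trees n = {T. oriented_tree T \<and> pverts T = {1..n}}"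

text \<open>
  \<^const>\<open>pmf_of_set\<close> is the uniform distribution only on finite nonempty sets. It is
  unspecified for \<open>n = 0\<close>, which does not affect limits.
\<close>

lemma finite_labelled_oriented_trees: "finite (labelled_oriented_trees n)"
proof (rule finite_subset)
  show "labelled_oriented_trees n \<subseteq>
      (\<lambda>E. \<lparr>pverts = {1..n}, parcs = E\<rparr>) ` Pow ({1..n} \<times> {1..n})"
  proof
    fix T assume "T \<in> labelled_oriented_trees n"
    then have wf: "pair_wf_digraph T" and V: "pverts T = {1..n}"
      by (auto simp: labelled_oriented_trees_def oriented_tree_def pair_digraph_def
          pair_fin_digraph_def)
    have "parcs T \<subseteq> {1..n} \<times> {1..n}"
      using pair_wf_digraph.wellformed'[OF wf] V by (auto intro!: subrelI)
    moreover have "T = \<lparr>pverts = {1..n}, parcs = parcs T\<rparr>"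
      using V by simp
    ultimately show "T \<in> (\<lambda>E. \<lparr>pverts = {1..n}, parcs = E\<rparr>) ` Pow ({1..n} \<times> {1..n})"
      by blast
  qed
qed simp

lemma labelled_oriented_trees_nonempty:
  assumes "n \<ge> 1"
  shows "labelled_oriented_trees n \<noteq> {}"
proof -
  define T :: "nat pair_pre_digraph" where "T = \<lparr>pverts = {1..n}, parcs = {1} \<times> {2..n}\<rparr>"
  define M where "M = with_proj (mk_symmetric (with_proj T))"
  have arcsM: "arcs M = {1} \<times> {2..n} \<union> {2..n} \<times> {1}"
    by (auto simp: M_def T_def mk_symmetric_def)
  have "pair_digraph T"
    using assms by unfold_locales (auto simp: T_def)
  moreover have "\<forall>u v. (u, v) \<in> parcs T \<longrightarrow> (v, u) \<notin> parcs T"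
    by (auto simp: T_def)
  moreover have "Digraph_Component.connected (with_proj T)"
    unfolding Digraph_Component.connected_def M_def[symmetric]
  proof (rule strongly_connectedI)
    show "verts M \<noteq> {}"
      using assms by (auto simp: M_def T_def mk_symmetric_def)
    interpret M: wf_digraph M
      by unfold_locales (use assms in \<open>auto simp: M_def T_def mk_symmetric_def\<close>)
    have V: "verts M = {1..n}"
      by (simp add: M_def T_def mk_symmetric_def)
    have ends: "arcs_ends M = arcs M"
      by (simp add: M_def)
    have to1: "w \<rightarrow>\<^sup>*\<^bsub>M\<^esub> 1" and from1: "1 \<rightarrow>\<^sup>*\<^bsub>M\<^esub> w" if "w \<in> verts M" for w
    proof -
      have "w \<rightarrow>\<^sup>*\<^bsub>M\<^esub> 1 \<and> 1 \<rightarrow>\<^sup>*\<^bsub>M\<^esub> w"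
      proof (cases "w = 1")
        case True
        with that show ?thesis by (simp add: M.reachable_refl)
      next
        case False
        with that V have "(w, 1) \<in> arcs_ends M" "(1, w) \<in> arcs_ends M"
          by (auto simp: ends arcsM)
        then show ?thesis by (blast intro: M.reachable_adjI)
      qed
      then show "w \<rightarrow>\<^sup>*\<^bsub>M\<^esub> 1" "1 \<rightarrow>\<^sup>*\<^bsub>M\<^esub> w" by auto
    qed
    show "u \<rightarrow>\<^sup>*\<^bsub>M\<^esub> v" if "u \<in> verts M" "v \<in> verts M" for u v
      using to1[OF that(1)] from1[OF that(2)] by (rule M.reachable_trans)
  qed
  moreover have "\<not> (pre_digraph.cycle M p \<and> length p \<ge> 3)" for p
  proof
    assume p: "pre_digraph.cycle M p \<and> length p \<ge> 3"
    then obtain e1 e2 e3 q where q: "p = e1 # e2 # e3 # q"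
      by (auto simp: numeral_3_eq_3 Suc_le_length_iff)
    have M_eqs: "pre_digraph.cas M = pcas" "pre_digraph.awalk_verts M = pawalk_verts"
      by (simp_all add: M_def cas_with_proj_eq awalk_verts_with_proj_eq)
    from p q obtain u where "set p \<subseteq> arcs M" "pcas u p u" "distinct (tl (pawalk_verts u p))"
      by (auto simp: pre_digraph.cycle_def pre_digraph.awalk_def M_eqs)
    moreover have "v \<in> set (pawalk_verts v l)" if "pcas v l w" for v w and l :: "(nat \<times> nat) list"
      using that by (cases l) auto
    ultimately show False
      unfolding q arcsM by (cases q) auto
  qed
  ultimately have "T \<in> labelled_oriented_trees n"
    by (auto simp: labelled_oriented_trees_def oriented_tree_def M_def T_def)
  then show ?thesis by blast
qed

end

theory Submission
  imports Defs "HOL-Real_Asymp.Real_Asymp"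
begin

text \<open>
  A star with centre \<open>u\<close> hanging off the rest of the tree by one arc at \<open>u\<close> can be cut off, and
  conversely glued to any vertex of any tree on the remaining vertices. Hence the number of
  trees containing prescribed disjoint pendant stars is expressed through the number of trees on
  fewer vertices. For stars that are single leaves, inclusion-exclusion turns this into a
  recursion for the number of oriented trees, with solution \<open>2 ^ (n - 1) * n ^ (n - 2)\<close>. With that
  formula one gets the first two moments of the number of pendant paths \<open>v \<leftarrow> u \<rightarrow> x\<close> (\<open>v\<close> a leaf,
  \<open>u\<close> of degree two) and of pendant stars \<open>v \<rightarrow> u \<rightarrow> w\<close>, \<open>x \<rightarrow> u\<close> (\<open>v\<close>, \<open>w\<close> leaves, \<open>u\<close> of degree
  three): the means are asymptotic to \<open>exp (-2) / 4 * n\<close> and \<open>exp (-3) / 8 * n\<close>, both above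
  \<open>n / 220\<close>, and the variances are \<open>o(n\<^sup>2)\<close>. Distinct occurrences are disjoint in large trees, so
  Chebyshev's inequality gives the claim.
\<close>

section \<open>Trees as connected arc sets of minimal size\<close>

text \<open>Walks are awkward for cutting and gluing, so all counting uses a cut criterion for
  connectedness together with the number of arcs, and an equivalence links this to the walk-based
  definition. What makes the moments exact is a rigidity of pendant stars with \<open>r\<close>
  vertices: in a tree with more than \<open>2 * r\<close> vertices, two different occurrences share
  no vertex and are not joined to each other. A pair of occurrences is therefore always two
  independent gluings onto a common remainder, and the second factorial moment has the same product
  form as the mean. Its leading term is the square of the mean, which leaves a variance of lower
  order. The threshold \<open>n / 220\<close> leaves room on both sides: above
  \<open>n / 250\<close> for rounding up, and below the means for the crude estimate
  \<open>exp 1 \<le> 3\<close>.\<close>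

text \<open>Cuts instead of walks: when a set is glued on by one arc, a cut of the union splits one
  of the two sides or separates the ends of that arc, so no walk has to be taken apart.\<close>

definition cut_connected :: "'a set \<Rightarrow> ('a \<times> 'a) set \<Rightarrow> bool" where
  "cut_connected V E \<longleftrightarrow> V \<noteq> {} \<and> E \<subseteq> V \<times> V \<and>
     (\<forall>S. V \<inter> S \<noteq> {} \<and> V - S \<noteq> {} \<longrightarrow> (\<exists>a b. (a, b) \<in> E \<and> (a \<in> S) \<noteq> (b \<in> S)))"

text \<open>The arc count stands in for acyclicity; it also excludes loops and opposite arcs, see
  \<open>tree_arcs_antisym\<close>.\<close>

definition tree_arcs :: "'a set \<Rightarrow> ('a \<times> 'a) set \<Rightarrow> bool" where
  "tree_arcs V E \<longleftrightarrow> finite V \<and> cut_connected V E \<and> card E + 1 = card V"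

definition link :: "bool \<Rightarrow> 'a \<Rightarrow> 'a \<Rightarrow> 'a \<times> 'a" where
  "link d u x = (if d then (u, x) else (x, u))"

lemma cut_connectedI:
  assumes "V \<noteq> {}" "E \<subseteq> V \<times> V"
    "\<And>S p q. p \<in> V \<Longrightarrow> p \<in> S \<Longrightarrow> q \<in> V \<Longrightarrow> q \<notin> S \<Longrightarrow> \<exists>a b. (a, b) \<in> E \<and> (a \<in> S) \<noteq> (b \<in> S)"
  shows "cut_connected V E"
  unfolding cut_connected_def
proof (intro conjI allI impI)
  fix S assume "V \<inter> S \<noteq> {} \<and> V - S \<noteq> {}"
  then obtain p q where "p \<in> V" "p \<in> S" "q \<in> V" "q \<notin> S"
    by blast
  then show "\<exists>a b. (a, b) \<in> E \<and> (a \<in> S) \<noteq> (b \<in> S)"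
    by (rule assms(3))
qed (use assms in simp_all)

lemma cut_connected_nonempty: "cut_connected V E \<Longrightarrow> V \<noteq> {}"
  by (simp add: cut_connected_def)

lemma cut_connected_subset: "cut_connected V E \<Longrightarrow> E \<subseteq> V \<times> V"
  by (simp add: cut_connected_def)

lemma cut_connectedE:
  assumes "cut_connected V E" "p \<in> V" "p \<in> S" "q \<in> V" "q \<notin> S"
  obtains a b where "(a, b) \<in> E" "(a \<in> S) \<noteq> (b \<in> S)" "a \<in> V" "b \<in> V"
proof -
  have "V \<inter> S \<noteq> {} \<and> V - S \<noteq> {}"
    using assms by blast
  then obtain a b where "(a, b) \<in> E" "(a \<in> S) \<noteq> (b \<in> S)"
    using assms(1) unfolding cut_connected_def by meson
  then show ?thesis
    using that cut_connected_subset[OF assms(1)] by blast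
qed

lemma tree_arcs_cut_connected: "tree_arcs V E \<Longrightarrow> cut_connected V E"
  by (simp add: tree_arcs_def)

lemma tree_arcs_subset: "tree_arcs V E \<Longrightarrow> E \<subseteq> V \<times> V"
  by (simp add: tree_arcs_def cut_connected_def)

lemma tree_arcs_finite: "tree_arcs V E \<Longrightarrow> finite E"
  by (meson tree_arcs_def tree_arcs_subset finite_cartesian_product finite_subset)

lemma tree_arcs_singleton: "tree_arcs {v} {}"
  by (auto simp: tree_arcs_def intro: cut_connectedI)

lemma card_join:
  assumes "finite W" "finite C" "W \<inter> C = {}" "E \<subseteq> W \<times> W" "F \<subseteq> C \<times> C" "u \<in> C" "x \<in> W"
  shows "card (insert (link d u x) (E \<union> F)) = card E + card F + 1"
proof -
  have fin: "finite E" "finite F"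
    using finite_subset[OF assms(4)] finite_subset[OF assms(5)] assms(1,2) by auto
  have "E \<inter> F = {}" "link d u x \<notin> E \<union> F"
    using assms by (auto simp: link_def)
  then show "card (insert (link d u x) (E \<union> F)) = card E + card F + 1"
    using fin by (simp add: card_Un_disjoint)
qed

lemma cut_connected_join:
  assumes "cut_connected W E" "cut_connected C F" "u \<in> C" "x \<in> W"
  shows "cut_connected (W \<union> C) (insert (link d u x) (E \<union> F))"
proof (rule cut_connectedI)
  show "W \<union> C \<noteq> {}"
    using assms(3) by blast
  show "insert (link d u x) (E \<union> F) \<subseteq> (W \<union> C) \<times> (W \<union> C)"
    using cut_connected_subset[OF assms(1)] cut_connected_subset[OF assms(2)] assms(3,4)
    by (auto simp: link_def)
  fix S p q assume pq: "p \<in> W \<union> C" "p \<in> S" "q \<in> W \<union> C" "q \<notin> S"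
  consider (W) p' q' where "p' \<in> W" "p' \<in> S" "q' \<in> W" "q' \<notin> S"
    | (C) p' q' where "p' \<in> C" "p' \<in> S" "q' \<in> C" "q' \<notin> S"
    | (link) "(x \<in> S) \<noteq> (u \<in> S)"
    using pq assms(3,4) by blast
  then show "\<exists>a b. (a, b) \<in> insert (link d u x) (E \<union> F) \<and> (a \<in> S) \<noteq> (b \<in> S)"
  proof cases
    case W
    then obtain a b where "(a, b) \<in> E" "(a \<in> S) \<noteq> (b \<in> S)"
      by (rule cut_connectedE[OF assms(1)])
    then show ?thesis by blast
  next
    case C
    then obtain a b where "(a, b) \<in> F" "(a \<in> S) \<noteq> (b \<in> S)"
      by (rule cut_connectedE[OF assms(2)])
    then show ?thesis by blast
  next
    case link
    then show ?thesis
      by (cases d) (auto simp: link_def)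
  qed
qed

text \<open>
  A cut of \<open>W\<close> is extended to \<open>W \<union> C\<close> by putting \<open>C\<close> on the side of its attachment vertex.
\<close>

lemma cut_connected_unjoin:
  assumes "cut_connected (W \<union> C) (insert (link d u x) (E \<union> F))"
    "W \<inter> C = {}" "E \<subseteq> W \<times> W" "F \<subseteq> C \<times> C" "u \<in> C" "x \<in> W"
  shows "cut_connected W E"
proof (rule cut_connectedI)
  show "W \<noteq> {}"
    using assms(6) by blast
  show "E \<subseteq> W \<times> W"
    by (rule assms(3))
  fix S p q assume pq: "p \<in> W" "p \<in> S" "q \<in> W" "q \<notin> S"
  define S' where "S' = W \<inter> S \<union> (if x \<in> S then C else {})"
  have "p \<in> W \<union> C" "p \<in> S'" "q \<in> W \<union> C" "q \<notin> S'"
    using pq assms(2) by (auto simp: S'_def)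
  then obtain a b where ab: "(a, b) \<in> insert (link d u x) (E \<union> F)" "(a \<in> S') \<noteq> (b \<in> S')"
    by (rule cut_connectedE[OF assms(1)])
  have "(a, b) \<in> E"
    using ab assms(2-6) by (auto simp: S'_def link_def split: if_splits)
  moreover have "(a \<in> S) \<noteq> (b \<in> S)"
    using ab(2) \<open>(a, b) \<in> E\<close> assms(2,3) by (auto simp: S'_def split: if_splits)
  ultimately show "\<exists>a b. (a, b) \<in> E \<and> (a \<in> S) \<noteq> (b \<in> S)"
    by blast
qed

lemma tree_arcs_join:
  assumes "tree_arcs W E" "tree_arcs C F" "W \<inter> C = {}" "u \<in> C" "x \<in> W"
  shows "tree_arcs (W \<union> C) (insert (link d u x) (E \<union> F))"
  unfolding tree_arcs_def
proof (intro conjI)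
  show "finite (W \<union> C)" "cut_connected (W \<union> C) (insert (link d u x) (E \<union> F))"
    using assms cut_connected_join by (auto simp: tree_arcs_def)
  show "card (insert (link d u x) (E \<union> F)) + 1 = card (W \<union> C)"
    using card_join[of W C E F u x d] assms tree_arcs_subset[OF assms(1)] tree_arcs_subset[OF assms(2)]
    by (simp add: tree_arcs_def card_Un_disjoint)
qed

lemma tree_arcs_unjoin:
  assumes "tree_arcs (W \<union> C) (insert (link d u x) (E \<union> F))" "tree_arcs C F"
    "W \<inter> C = {}" "E \<subseteq> W \<times> W" "u \<in> C" "x \<in> W"
  shows "tree_arcs W E"
  unfolding tree_arcs_def
proof (intro conjI)
  have FC: "F \<subseteq> C \<times> C"
    by (rule tree_arcs_subset[OF assms(2)])
  show "finite W"
    using assms(1) by (simp add: tree_arcs_def)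
  show "cut_connected W E"
    using assms FC by (intro cut_connected_unjoin[of W C d u x E F]) (auto simp: tree_arcs_def)
  show "card E + 1 = card W"
    using card_join[of W C E F u x d] card_Un_disjoint[of W C] assms FC by (simp add: tree_arcs_def)
qed

section \<open>Growing subtrees: spanning trees, minimality, leaves\<close>

lemma tree_arcs_extend:
  assumes "cut_connected V E" "tree_arcs W D" "W \<subset> V" "D \<subseteq> E"
  obtains d u x where "u \<in> V - W" "x \<in> W" "link d u x \<in> E" "tree_arcs (insert u W) (insert (link d u x) D)"
proof -
  obtain p q where pq: "p \<in> V" "p \<in> W" "q \<in> V" "q \<notin> W"
    using assms(3) cut_connected_nonempty[OF tree_arcs_cut_connected[OF assms(2)]] by blast
  obtain a b where ab: "(a, b) \<in> E" "(a \<in> W) \<noteq> (b \<in> W)" "a \<in> V" "b \<in> V"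
    by (rule cut_connectedE[OF assms(1) pq])
  obtain d u x where l: "(a, b) = link d u x" "u \<in> V - W" "x \<in> W"
  proof (cases "a \<in> W")
    case True
    then show ?thesis using ab that[of False b a] by (auto simp: link_def)
  next
    case False
    then show ?thesis using ab that[of True a b] by (auto simp: link_def)
  qed
  have "tree_arcs (W \<union> {u}) (insert (link d u x) (D \<union> {}))"
    by (rule tree_arcs_join[OF assms(2) tree_arcs_singleton]) (use l in auto)
  then show ?thesis
    using that[of u x d] l ab by simp
qed

text \<open>A largest \<open>W\<close> that carries a tree inside \<open>E\<close> must be all of
  \<open>V\<close>, since otherwise \<open>tree_arcs_extend\<close> enlarges it.\<close>

lemma spanning_tree_arcs:
  assumes "finite V" "cut_connected V E"
  obtains D where "D \<subseteq> E" "tree_arcs V D"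
proof -
  define P where "P = (\<lambda>W. W \<subseteq> V \<and> (\<exists>D\<subseteq>E. tree_arcs W D))"
  obtain v where "v \<in> V"
    using cut_connected_nonempty[OF assms(2)] by blast
  then have "P {v}"
    using tree_arcs_singleton[of v] by (auto simp: P_def)
  moreover have "\<forall>W. P W \<longrightarrow> card W < Suc (card V)"
    using assms(1) by (auto simp: P_def less_Suc_eq_le intro: card_mono)
  ultimately have "\<exists>W. P W \<and> (\<forall>W'. P W' \<longrightarrow> card W' \<le> card W)"
    by (rule ex_has_greatest_nat)
  then obtain W where W: "P W" "\<And>W'. P W' \<Longrightarrow> card W' \<le> card W"
    by auto
  then obtain D where D: "D \<subseteq> E" "tree_arcs W D" "W \<subseteq> V"
    by (auto simp: P_def)
  have "W = V"
  proof (rule ccontr)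
    assume "W \<noteq> V"
    then have "W \<subset> V"
      using D by blast
    then obtain d u x where u: "u \<in> V - W" "link d u x \<in> E" "tree_arcs (insert u W) (insert (link d u x) D)"
      using tree_arcs_extend[OF assms(2) D(2) _ D(1)] by metis
    then have "P (insert u W)"
      using D unfolding P_def by blast
    moreover have "finite W"
      using D by (simp add: tree_arcs_def)
    ultimately show False
      using W(2)[of "insert u W"] u(1) by simp
  qed
  then show ?thesis
    using that D by blast
qed

text \<open>A spanning tree inside \<open>D\<close> already has as many arcs as \<open>E\<close>.
  Configurations impossible in a tree are excluded below by deleting an arc and checking that every
  cut is still crossed.\<close>

lemma tree_arcs_minimal:
  assumes "tree_arcs V E" "D \<subseteq> E" "cut_connected V D"
  shows "D = E"
proof -
  have "finite V"
    using assms by (simp add: tree_arcs_def)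
  then obtain D' where D': "D' \<subseteq> D" "tree_arcs V D'"
    by (rule spanning_tree_arcs[OF _ assms(3)])
  then have "card D' = card E"
    using assms(1) by (simp add: tree_arcs_def)
  moreover have "D' \<subseteq> E"
    using D'(1) assms(2) by blast
  ultimately have "D' = E"
    by (simp add: card_subset_eq[OF tree_arcs_finite[OF assms(1)]])
  then show ?thesis
    using D'(1) assms(2) by blast
qed

text \<open>Splits a tree at \<open>C\<close>: \<open>E \<inter> touching C\<close> is everything at
  \<open>C\<close>, and \<open>E - touching C\<close> is the remainder.\<close>

definition touching :: "'a set \<Rightarrow> ('a \<times> 'a) set" where
  "touching C = {(a, b). a \<in> C \<or> b \<in> C}"

text \<open>The growth argument again, with \<open>W\<close> a largest proper subset: one more
  vertex \<open>u\<close> then fills \<open>V\<close>, and by minimality the arc that joins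
  \<open>u\<close> is the only one at \<open>u\<close>.\<close>

lemma tree_arcs_ex_leaf:
  assumes "tree_arcs V E" "card V \<ge> 2"
  obtains d u x where "u \<in> V" "x \<in> V" "u \<noteq> x" "E \<inter> touching {u} = {link d u x}"
proof -
  have cc: "cut_connected V E" and fin: "finite V"
    using assms(1) by (simp_all add: tree_arcs_def)
  define P where "P = (\<lambda>W. W \<subset> V \<and> (\<exists>D\<subseteq>E. tree_arcs W D))"
  obtain v where "v \<in> V"
    using cut_connected_nonempty[OF cc] by blast
  moreover have "V \<noteq> {v}"
    using assms(2) by auto
  ultimately have "P {v}"
    using tree_arcs_singleton[of v] by (auto simp: P_def)
  moreover have "\<forall>W. P W \<longrightarrow> card W < Suc (card V)"
    using fin by (auto simp: P_def less_Suc_eq_le intro: card_mono)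
  ultimately have "\<exists>W. P W \<and> (\<forall>W'. P W' \<longrightarrow> card W' \<le> card W)"
    by (rule ex_has_greatest_nat)
  then obtain W where W: "P W" "\<And>W'. P W' \<Longrightarrow> card W' \<le> card W"
    by auto
  then obtain D where D: "D \<subseteq> E" "tree_arcs W D" "W \<subset> V"
    by (auto simp: P_def)
  obtain d u x where u: "u \<in> V - W" "x \<in> W" "link d u x \<in> E" "tree_arcs (insert u W) (insert (link d u x) D)"
    using tree_arcs_extend[OF cc D(2,3,1)] by metis
  have "finite W"
    using D(2) by (simp add: tree_arcs_def)
  then have "\<not> P (insert u W)"
    using W(2)[of "insert u W"] u(1) by auto
  then have V: "insert u W = V"
    using D(1,3) u(1,3,4) unfolding P_def by blast
  have "insert (link d u x) D = E"
    using tree_arcs_minimal[OF assms(1), of "insert (link d u x) D"] u(3) D(1) tree_arcs_cut_connected[OF u(4)] V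
    by simp
  then have "E \<inter> touching {u} = {link d u x}"
    using tree_arcs_subset[OF D(2)] u(1) by (auto simp: touching_def link_def)
  then show ?thesis
    using that[of u x d] u D by blast
qed

text \<open>An arc whose reverse is present can be deleted without leaving a cut uncrossed, against
  minimality. The case \<open>a = b\<close> excludes loops.\<close>

lemma tree_arcs_antisym:
  assumes "tree_arcs V E" "(a, b) \<in> E"
  shows "(b, a) \<notin> E"
proof
  assume ba: "(b, a) \<in> E"
  have "cut_connected V (E - {(a, b)})"
  proof (rule cut_connectedI)
    show "V \<noteq> {}"
      by (rule cut_connected_nonempty[OF tree_arcs_cut_connected[OF assms(1)]])
    show "E - {(a, b)} \<subseteq> V \<times> V"
      using tree_arcs_subset[OF assms(1)] by blast
    fix S p q assume "p \<in> V" "p \<in> S" "q \<in> V" "q \<notin> S"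
    then obtain y z where "(y, z) \<in> E" "(y \<in> S) \<noteq> (z \<in> S)"
      by (rule cut_connectedE[OF tree_arcs_cut_connected[OF assms(1)]])
    then show "\<exists>y z. (y, z) \<in> E - {(a, b)} \<and> (y \<in> S) \<noteq> (z \<in> S)"
      using ba by (cases "(y, z) = (a, b)") auto
  qed
  then have "E - {(a, b)} = E"
    using tree_arcs_minimal[OF assms(1), of "E - {(a, b)}"] by blast
  then show False
    using assms(2) by blast
qed

section \<open>Agreement with the walk-based definition of oriented trees\<close>

lemma walk_crosses:
  assumes "pcas b q a" "set q \<subseteq> R" "(b \<in> S) \<noteq> (a \<in> S)"
  shows "\<exists>y z. (y, z) \<in> R \<and> (y \<in> S) \<noteq> (z \<in> S)"
  using assms
proof (induction q arbitrary: b)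
  case (Cons e q)
  then show ?case
    by (cases e; cases "(snd e \<in> S) = (a \<in> S)") auto
qed simp

text \<open>A walk that leaves \<open>S\<close> uses a crossing arc; conversely, the set of vertices
  reachable from \<open>u\<close> would be an uncrossed cut. The general form, for any digraph whose
  arcs are pairs, also covers the induced subgraph in \<open>pendant\<close>.\<close>

lemma connected_iff_cut_connected:
  assumes "tail G = fst" "head G = snd" "arcs G \<subseteq> verts G \<times> verts G"
  shows "Digraph_Component.connected G \<longleftrightarrow> cut_connected (verts G) (arcs G)"
proof -
  define M where "M = with_proj (mk_symmetric G)"
  have arcsM: "arcs_ends M = arcs G \<union> (arcs G)\<inverse>" and vertsM: "verts M = verts G"
    using assms(1,2) by (auto simp: M_def mk_symmetric_def)
  show ?thesis
  proof
    assume "Digraph_Component.connected G"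
    then have ne: "verts G \<noteq> {}"
      and reach: "\<And>u v. u \<in> verts G \<Longrightarrow> v \<in> verts G \<Longrightarrow> (u, v) \<in> rtrancl_on (verts G) (arcs G \<union> (arcs G)\<inverse>)"
      by (auto simp: Digraph_Component.connected_def strongly_connected_def M_def[symmetric] vertsM
          reachable_def arcsM)
    show "cut_connected (verts G) (arcs G)"
    proof (rule cut_connectedI[OF ne assms(3)])
      fix S p q assume pq: "p \<in> verts G" "p \<in> S" "q \<in> verts G" "q \<notin> S"
      from reach[OF pq(1,3)] have "q \<notin> S \<longrightarrow> (\<exists>a b. (a, b) \<in> arcs G \<and> (a \<in> S) \<noteq> (b \<in> S))"
      proof (induction rule: rtrancl_on_induct)
        case (step y z)
        then show ?case
          by (cases "y \<in> S") auto
      qed (use pq in simp)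
      then show "\<exists>a b. (a, b) \<in> arcs G \<and> (a \<in> S) \<noteq> (b \<in> S)"
        using pq(4) by blast
    qed
  next
    assume cc: "cut_connected (verts G) (arcs G)"
    have "u \<rightarrow>\<^sup>*\<^bsub>M\<^esub> v" if u: "u \<in> verts M" and v: "v \<in> verts M" for u v
    proof (rule ccontr)
      assume nv: "\<not> u \<rightarrow>\<^sup>*\<^bsub>M\<^esub> v"
      define S where "S = {w. u \<rightarrow>\<^sup>*\<^bsub>M\<^esub> w}"
      have "u \<in> S" "v \<notin> S"
        using u nv by (auto simp: S_def reachable_def)
      then obtain a b where ab: "(a, b) \<in> arcs G" "(a \<in> S) \<noteq> (b \<in> S)" "a \<in> verts G" "b \<in> verts G"
        using cut_connectedE[OF cc] u v vertsM by metis
      moreover have "z \<in> S" if "y \<in> S" "(y, z) \<in> arcs_ends M" "z \<in> verts G" for y z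
        using that by (auto simp: S_def reachable_def vertsM intro: rtrancl_on_into_rtrancl_on)
      ultimately show False
        by (auto simp: arcsM)
    qed
    then show "Digraph_Component.connected G"
      unfolding M_def
      using cut_connected_nonempty[OF cc]
      by (simp add: Digraph_Component.connected_def strongly_connected_def vertsM[unfolded M_def])
  qed
qed

section \<open>Cycles of length at least three in the symmetric closure\<close>

lemma pawalk_verts_conv: "pcas b q a \<Longrightarrow> pawalk_verts b q = b # map snd q"
proof (induction q arbitrary: b)
  case (Cons e q)
  then show ?case by (cases e) simp
qed simp

lemma pcas_fst_subset: "pcas c q a \<Longrightarrow> fst ` set q \<subseteq> insert c (snd ` set q)"
proof (induction q arbitrary: c)
  case (Cons e q)
  then show ?case by (cases e) fastforce
qed simp

lemma pcas_last: "pcas c q a \<Longrightarrow> q \<noteq> [] \<Longrightarrow> snd (last q) = a"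
proof (induction q arbitrary: c)
  case (Cons e q)
  then show ?case by (cases e; cases q) auto
qed simp

text \<open>The walk \<open>q\<close> closes a cycle whose first step is \<open>(a, b)\<close>. No
  arc of \<open>q\<close> enters \<open>b\<close>, and the only one leaving \<open>b\<close> is the
  first, which does not end at \<open>a\<close> because \<open>a\<close> is reached by a later arc.
  A walk of length 1 could be \<open>(b, a)\<close> itself, the 2-cycle of an edge.\<close>

lemma cycle_arcs_notin:
  assumes "pcas b q a" "distinct (pawalk_verts b q)" "length q \<ge> 2"
  shows "(a, b) \<notin> set q" "(b, a) \<notin> set q"
proof -
  obtain c r where q: "q = (b, c) # r" "pcas c r a" "r \<noteq> []"
    using assms(1,3) by (cases q; cases "tl q") auto
  have d: "distinct (b # c # map snd r)"
    using assms(2) pawalk_verts_conv[OF assms(1)] q(1) by simp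
  have bs: "b \<notin> snd ` set q"
    using d q(1) by auto
  then show "(a, b) \<notin> set q"
    by force
  have "c \<noteq> a"
    using d q(3) pcas_last[OF q(2,3)] last_in_set[OF q(3)] by force
  moreover have "b \<notin> fst ` set r"
    using pcas_fst_subset[OF q(2)] d by auto
  ultimately show "(b, a) \<notin> set q"
    using q(1) by force
qed

lemma cycle_with_proj_iff:
  fixes M :: "'a pair_pre_digraph"
  shows "pre_digraph.cycle (with_proj M) p \<longleftrightarrow>
    (\<exists>u. u \<in> pverts M \<and> set p \<subseteq> parcs M \<and> pcas u p u \<and> distinct (tl (pawalk_verts u p)) \<and> p \<noteq> [])"
  by (simp add: pre_digraph.cycle_def pre_digraph.awalk_def cas_with_proj_eq awalk_verts_with_proj_eq)

text \<open>After deletion of the edge of the first step, the rest of the cycle still joins its ends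
  and so crosses every cut that this edge crossed; this contradicts minimality.\<close>

lemma tree_arcs_acyclic:
  assumes "tree_arcs V E" "set p \<subseteq> E \<union> E\<inverse>" "pcas a p a" "distinct (tl (pawalk_verts a p))" "length p \<ge> 3"
  shows False
proof -
  obtain b q where p: "p = (a, b) # q" "pcas b q a" "length q \<ge> 2" "distinct (pawalk_verts b q)"
    using assms(3,4,5) by (cases p) (auto simp: numeral_2_eq_2 numeral_3_eq_3)
  define D where "D = E - {(a, b), (b, a)}"
  have q: "set q \<subseteq> D \<union> D\<inverse>"
    using cycle_arcs_notin[OF p(2,4,3)] assms(2) p(1) by (auto simp: D_def)
  have "cut_connected V D"
  proof (rule cut_connectedI)
    show "V \<noteq> {}"
      by (rule cut_connected_nonempty[OF tree_arcs_cut_connected[OF assms(1)]])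
    show "D \<subseteq> V \<times> V"
      using tree_arcs_subset[OF assms(1)] by (auto simp: D_def)
    fix S u v assume "u \<in> V" "u \<in> S" "v \<in> V" "v \<notin> S"
    then obtain y z where yz: "(y, z) \<in> E" "(y \<in> S) \<noteq> (z \<in> S)"
      by (rule cut_connectedE[OF tree_arcs_cut_connected[OF assms(1)]])
    show "\<exists>y z. (y, z) \<in> D \<and> (y \<in> S) \<noteq> (z \<in> S)"
    proof (cases "(y, z) \<in> D")
      case False
      then have "(b \<in> S) \<noteq> (a \<in> S)"
        using yz by (auto simp: D_def)
      then show ?thesis
        using walk_crosses[OF p(2) q, of S] by auto
    qed (use yz in blast)
  qed
  then have "D = E"
    using tree_arcs_minimal[OF assms(1)] by (auto simp: D_def)
  then show False
    using assms(2) p(1) by (auto simp: D_def)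
qed

text \<open>An arc outside a spanning tree \<open>D\<close> would close a cycle with the path of
  \<open>D\<close> between its ends.\<close>

lemma tree_arcs_of_acyclic:
  assumes "finite V" "cut_connected V E" "\<And>a b. (a, b) \<in> E \<Longrightarrow> (b, a) \<notin> E"
    and acyclic: "\<And>p a. a \<in> V \<Longrightarrow> set p \<subseteq> E \<union> E\<inverse> \<Longrightarrow> pcas a p a \<Longrightarrow> distinct (tl (pawalk_verts a p)) \<Longrightarrow>
      length p < 3"
  shows "tree_arcs V E"
proof -
  obtain D where D: "D \<subseteq> E" "tree_arcs V D"
    by (rule spanning_tree_arcs[OF assms(1,2)])
  have "E \<subseteq> D"
  proof (rule ccontr)
    assume "\<not> E \<subseteq> D"
    then obtain a b where ab: "(a, b) \<in> E" "(a, b) \<notin> D"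
      by auto
    have V: "a \<in> V" "b \<in> V"
      using cut_connected_subset[OF assms(2)] ab by auto
    define T where "T = \<lparr>pverts = V, parcs = D\<rparr>"
    define M where "M = mk_symmetric (with_proj T)"
    have M: "pverts M = V" "parcs M = D \<union> D\<inverse>"
      by (auto simp: M_def T_def mk_symmetric_def)
    interpret M: wf_digraph "with_proj M"
      using tree_arcs_subset[OF D(2)] by unfold_locales (auto simp: M)
    have "Digraph_Component.connected (with_proj T)"
      using connected_iff_cut_connected[of "with_proj T"] tree_arcs_subset[OF D(2)] tree_arcs_cut_connected[OF D(2)]
      by (simp add: T_def)
    then have "b \<rightarrow>\<^sup>*\<^bsub>with_proj M\<^esub> a"
      using V by (auto simp: Digraph_Component.connected_def M_def[symmetric] strongly_connected_def M)
    then obtain p where "pre_digraph.apath (with_proj M) b p a"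
      unfolding M.reachable_apath ..
    then have p: "set p \<subseteq> D \<union> D\<inverse>" "pcas b p a" "distinct (pawalk_verts b p)"
      by (auto simp: pre_digraph.apath_def pre_digraph.awalk_def cas_with_proj_eq awalk_verts_with_proj_eq M)
    have "length ((a, b) # p) < 3"
      using p D(1) ab V by (intro acyclic[of a]) auto
    \<comment> \<open>The cycle has to be short: an empty path means that \<open>(a, b)\<close> is a
      loop, a single step that \<open>D\<close> contains \<open>(a, b)\<close> or its reverse. Both
      are excluded.\<close>
    then consider "p = []" | e where "p = [e]"
      by (cases p) auto
    then show False
    proof cases
      case 1
      then show False
        using p(2) ab(1) assms(3) by auto
    next
      case 2
      then have "(b, a) \<in> D \<or> (a, b) \<in> D"
        using p(1,2) by (cases e) auto
      then show False
        using assms(3)[OF ab(1)] ab(2) D(1) by blast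
    qed
  qed
  then show ?thesis
    using D by auto
qed

lemma oriented_tree_iff_tree_arcs: "oriented_tree T \<longleftrightarrow> tree_arcs (pverts T) (parcs T)"
proof -
  define M where "M = mk_symmetric (with_proj T)"
  have M: "pverts M = pverts T" "parcs M = parcs T \<union> (parcs T)\<inverse>"
    by (auto simp: M_def mk_symmetric_def)
  have conn: "Digraph_Component.connected (with_proj T) \<longleftrightarrow> cut_connected (pverts T) (parcs T)"
    if "parcs T \<subseteq> pverts T \<times> pverts T"
    using connected_iff_cut_connected[of "with_proj T"] that by simp
  show ?thesis
  proof
    assume T: "oriented_tree T"
    then have pd: "pair_digraph T"
      by (simp add: oriented_tree_def)
    then have sub: "parcs T \<subseteq> pverts T \<times> pverts T"
      using pair_wf_digraph.wellformed'[of T] by (auto simp: pair_digraph_def pair_fin_digraph_def)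
    show "tree_arcs (pverts T) (parcs T)"
    proof (rule tree_arcs_of_acyclic)
      show "finite (pverts T)"
        using pd by (simp add: pair_digraph_def pair_fin_digraph_def pair_fin_digraph_axioms_def)
      show "cut_connected (pverts T) (parcs T)"
        using T conn[OF sub] by (simp add: oriented_tree_def)
      show "(b, a) \<notin> parcs T" if "(a, b) \<in> parcs T" for a b
        using T that by (simp add: oriented_tree_def)
      show "length p < 3" if "a \<in> pverts T" "set p \<subseteq> parcs T \<union> (parcs T)\<inverse>" "pcas a p a"
        "distinct (tl (pawalk_verts a p))" for p a
      proof (rule ccontr)
        assume "\<not> length p < 3"
        then have "length p \<ge> 3 \<and> pre_digraph.cycle (with_proj M) p"
          using that by (auto simp: cycle_with_proj_iff M)
        then show False
          using T by (auto simp: oriented_tree_def M_def)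
      qed
    qed
  next
    assume T: "tree_arcs (pverts T) (parcs T)"
    have sub: "parcs T \<subseteq> pverts T \<times> pverts T"
      by (rule tree_arcs_subset[OF T])
    have "(b, b) \<notin> parcs T" for b
      using tree_arcs_antisym[OF T, of b b] by blast
    then have "fst e \<noteq> snd e" if "e \<in> parcs T" for e
      using that by (cases e) auto
    moreover have "finite (pverts T)"
      using T by (simp add: tree_arcs_def)
    ultimately have "pair_digraph T"
      using sub tree_arcs_finite[OF T] by unfold_locales auto
    moreover have "Digraph_Component.connected (with_proj T)"
      using conn[OF sub] tree_arcs_cut_connected[OF T] by simp
    moreover have "\<not> (pre_digraph.cycle (with_proj M) p \<and> length p \<ge> 3)" for p
      using tree_arcs_acyclic[OF T, of p] by (auto simp: cycle_with_proj_iff M)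
    ultimately show "oriented_tree T"
      using tree_arcs_antisym[OF T] by (auto simp: oriented_tree_def M_def)
  qed
qed

section \<open>Counting trees with prescribed pendant subtrees\<close>

definition trees :: "'a set \<Rightarrow> ('a \<times> 'a) set set" where
  "trees V = {E. tree_arcs V E}"

lemma finite_trees: "finite V \<Longrightarrow> finite (trees V)"
  by (rule finite_subset[of _ "Pow (V \<times> V)"]) (auto simp: trees_def dest: tree_arcs_subset)

text \<open>
  \<open>K\<close> is the set of allowed pairs of a direction (\<open>True\<close> for an arc leaving \<open>C\<close>) and an
  attachment vertex in \<open>C\<close>; the other end of the attaching arc ranges over \<open>R\<close>.
\<close>

definition attached ::
  "('a \<times> 'a) set \<Rightarrow> 'a set \<Rightarrow> ('a \<times> 'a) set \<Rightarrow> (bool \<times> 'a) set \<Rightarrow> 'a set \<Rightarrow> bool" where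
  "attached E C F K R \<longleftrightarrow>
     (\<exists>d u x. (d, u) \<in> K \<and> x \<in> R \<and> E \<inter> touching C = insert (link d u x) F)"

lemma link_inject:
  assumes "link d u x = link d' u' x'" "u \<in> C" "u' \<in> C" "x \<notin> C" "x' \<notin> C"
  shows "d = d' \<and> u = u' \<and> x = x'"
  using assms by (auto simp: link_def split: if_splits)

lemma join_touching:
  assumes "E \<subseteq> (V - C) \<times> (V - C)" "F \<subseteq> C \<times> C" "u \<in> C"
  shows "insert (link d u x) (E \<union> F) \<inter> touching C = insert (link d u x) F"
    "insert (link d u x) (E \<union> F) - touching C = E"
  using assms by (auto simp: touching_def link_def)

lemma tree_arcs_detach:
  assumes "tree_arcs V E" "tree_arcs C F" "C \<subseteq> V" "u \<in> C" "x \<in> V - C"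
    "E \<inter> touching C = insert (link d u x) F"
  shows "tree_arcs (V - C) (E - touching C)"
proof (rule tree_arcs_unjoin[of "V - C" C d u x])
  have "(V - C) \<union> C = V"
    using assms(3) by blast
  moreover have "insert (link d u x) ((E - touching C) \<union> F) = E"
    using assms(6) by blast
  ultimately show "tree_arcs ((V - C) \<union> C) (insert (link d u x) ((E - touching C) \<union> F))"
    using assms(1) by simp
  show "E - touching C \<subseteq> (V - C) \<times> (V - C)"
    using tree_arcs_subset[OF assms(1)] by (auto simp: touching_def)
qed (use assms in auto)

text \<open>Deleting the arcs at \<open>C\<close> undoes the gluing, and the link is recovered as
  the only arc at \<open>C\<close> outside \<open>F\<close>. The predicate \<open>P\<close> carries
  conditions on the remainder, which allows several parts to be cut off one after another.\<close>

lemma bij_betw_attach: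
  assumes CF: "tree_arcs C F" and "C \<subseteq> V" and K: "K \<subseteq> UNIV \<times> C" and R: "R \<subseteq> V - C"
  shows "bij_betw (\<lambda>(E, (d, u), x). insert (link d u x) (E \<union> F))
    ({E \<in> trees (V - C). P E} \<times> K \<times> R)
    {E \<in> trees V. attached E C F K R \<and> P (E - touching C)}" (is "bij_betw ?f ?A ?B")
proof -
  have F: "F \<subseteq> C \<times> C"
    by (rule tree_arcs_subset[OF CF])
  have V: "(V - C) \<union> C = V"
    using assms(2) by blast
  show ?thesis
    unfolding bij_betw_def
  proof (intro conjI subset_antisym)
    show "inj_on ?f ?A"
    proof (rule inj_onI)
      fix p p' assume p: "p \<in> ?A" and p': "p' \<in> ?A" and eq: "?f p = ?f p'"
      obtain E d u x E' d' u' x' where pp: "p = (E, (d, u), x)" "p' = (E', (d', u'), x')"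
        by (cases p; cases p') auto
      have E: "E \<subseteq> (V - C) \<times> (V - C)" "E' \<subseteq> (V - C) \<times> (V - C)"
        using p p' by (auto simp: pp trees_def dest!: tree_arcs_subset)
      have u: "u \<in> C" "u' \<in> C" "x \<notin> C" "x' \<notin> C"
        using p p' K R by (auto simp: pp)
      have eq': "insert (link d u x) (E \<union> F) = insert (link d' u' x') (E' \<union> F)"
        using eq by (simp add: pp)
      have "E = E'"
        using eq' join_touching(2)[OF E(1) F u(1)] join_touching(2)[OF E(2) F u(2)] by metis
      moreover have "insert (link d u x) F = insert (link d' u' x') F"
        using eq' join_touching(1)[OF E(1) F u(1)] join_touching(1)[OF E(2) F u(2)] by metis
      moreover have "link d u x \<notin> F" "link d' u' x' \<notin> F"
        using F u by (auto simp: link_def)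
      ultimately show "p = p'"
        using link_inject[of d u x d' u' x' C] u by (auto simp: pp)
    qed
    show "?f ` ?A \<subseteq> ?B"
    proof safe
      fix E d u x assume E: "E \<in> trees (V - C)" "P E" and d: "(d, u) \<in> K" and x: "x \<in> R"
      have u: "u \<in> C" and xV: "x \<in> V - C"
        using d x K R by auto
      have sub: "E \<subseteq> (V - C) \<times> (V - C)"
        using E by (auto simp: trees_def dest!: tree_arcs_subset)
      have "tree_arcs ((V - C) \<union> C) (insert (link d u x) (E \<union> F))"
        by (rule tree_arcs_join[OF _ CF _ u xV]) (use E(1) in \<open>auto simp: trees_def\<close>)
      then show "insert (link d u x) (E \<union> F) \<in> trees V"
        unfolding V trees_def by simp
      show "attached (insert (link d u x) (E \<union> F)) C F K R"
        unfolding attached_def using join_touching(1)[OF sub F u] d x by blast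
      show "P (insert (link d u x) (E \<union> F) - touching C)"
        unfolding join_touching(2)[OF sub F u] by (rule E(2))
    qed
    show "?B \<subseteq> ?f ` ?A"
    proof
      fix E assume "E \<in> ?B"
      then have E: "tree_arcs V E" "P (E - touching C)" and att: "attached E C F K R"
        by (auto simp: trees_def)
      from att obtain d u x where d: "(d, u) \<in> K" "x \<in> R" "E \<inter> touching C = insert (link d u x) F"
        unfolding attached_def by blast
      define E' where "E' = E - touching C"
      have u: "u \<in> C" "x \<in> V - C"
        using d K R by auto
      have eq: "E = insert (link d u x) (E' \<union> F)"
        using d(3) by (auto simp: E'_def)
      have "tree_arcs (V - C) E'"
        unfolding E'_def by (rule tree_arcs_detach[OF E(1) CF assms(2) u d(3)])
      then have "(E', (d, u), x) \<in> ?A"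
        using d E(2) by (simp add: trees_def E'_def)
      moreover have "E = ?f (E', (d, u), x)"
        using eq by simp
      ultimately show "E \<in> ?f ` ?A"
        by (rule rev_image_eqI)
    qed
  qed
qed

text \<open>Cutting off \<open>C\<close> could affect the arcs at \<open>D\<close> only through the
  link, whose outer end lies in \<open>R\<close> and so avoids \<open>D\<close>.\<close>

lemma touching_disjoint_attached:
  assumes "attached E C F K R" "F \<subseteq> C \<times> C" "K \<subseteq> UNIV \<times> C" "D \<inter> C = {}" "R \<inter> D = {}"
  shows "(E - touching C) \<inter> touching D = E \<inter> touching D"
proof -
  obtain d u x where d: "(d, u) \<in> K" "x \<in> R" "E \<inter> touching C = insert (link d u x) F"
    using assms(1) unfolding attached_def by blast
  have "u \<notin> D" "x \<notin> D"
    using d(1,2) assms by auto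
  then have "insert (link d u x) F \<inter> touching D = {}"
    using assms(2,4) by (auto simp: touching_def link_def)
  then show ?thesis
    unfolding d(3)[symmetric] by blast
qed

text \<open>All parts are glued to the common remainder \<open>R\<close>, never to one another.
  Hence the links are chosen independently, and cutting off one part leaves the conditions on the
  others unchanged.\<close>

lemma card_attached:
  assumes "finite I" "finite V" "\<And>i. i \<in> I \<Longrightarrow> tree_arcs (C i) (F i)" "disjoint_family_on C I"
    "\<And>i. i \<in> I \<Longrightarrow> C i \<subseteq> V" "\<And>i. i \<in> I \<Longrightarrow> K i \<subseteq> UNIV \<times> C i"
  defines "R \<equiv> V - (\<Union>i\<in>I. C i)"
  shows "card {E \<in> trees V. \<forall>i\<in>I. attached E (C i) (F i) (K i) R} =
    card (trees R) * (\<Prod>i\<in>I. card (K i) * card R)"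
  using assms(1-6) unfolding R_def
proof (induction I arbitrary: V rule: finite_induct)
  case empty
  then show ?case by simp
next
  case (insert i I)
  define R where "R = V - (\<Union>j\<in>insert i I. C j)"
  have R: "R = (V - C i) - (\<Union>j\<in>I. C j)"
    by (auto simp: R_def)
  have CF: "tree_arcs (C i) (F i)" and Ci: "C i \<subseteq> V" and K: "K i \<subseteq> UNIV \<times> C i"
    using insert.prems by auto
  have disj: "C j \<inter> C i = {}" if "j \<in> I" for j
    using insert.prems(3) insert.hyps(2) that by (force simp: disjoint_family_on_def)
  have RV: "R \<subseteq> V - C i"
    by (auto simp: R_def)
  have "card {E \<in> trees V. \<forall>j\<in>insert i I. attached E (C j) (F j) (K j) R} =
    card {E \<in> trees V. attached E (C i) (F i) (K i) R \<and>
      (\<forall>j\<in>I. attached (E - touching (C i)) (C j) (F j) (K j) R)}"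
  proof (rule arg_cong[where f = card], rule Collect_cong, rule conj_cong[OF refl])
    fix E
    have "attached (E - touching (C i)) (C j) (F j) (K j) R \<longleftrightarrow> attached E (C j) (F j) (K j) R"
      if "attached E (C i) (F i) (K i) R" "j \<in> I" for j
    proof -
      have "R \<inter> C j = {}"
        using that(2) by (auto simp: R_def)
      then have "(E - touching (C i)) \<inter> touching (C j) = E \<inter> touching (C j)"
        using touching_disjoint_attached[OF that(1) tree_arcs_subset[OF CF] K disj[OF that(2)]] by simp
      then show ?thesis
        by (simp add: attached_def)
    qed
    then show "(\<forall>j\<in>insert i I. attached E (C j) (F j) (K j) R) \<longleftrightarrow>
      attached E (C i) (F i) (K i) R \<and> (\<forall>j\<in>I. attached (E - touching (C i)) (C j) (F j) (K j) R)"
      by auto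
  qed
  also have "\<dots> = card ({E \<in> trees (V - C i). \<forall>j\<in>I. attached E (C j) (F j) (K j) R} \<times> K i \<times> R)"
    using bij_betw_same_card[OF bij_betw_attach[OF CF Ci K RV]] by simp
  also have "\<dots> = card {E \<in> trees (V - C i). \<forall>j\<in>I. attached E (C j) (F j) (K j) R} * (card (K i) * card R)"
    by (simp add: card_cartesian_product)
  also have "card {E \<in> trees (V - C i). \<forall>j\<in>I. attached E (C j) (F j) (K j) R} =
    card (trees R) * (\<Prod>j\<in>I. card (K j) * card R)"
    unfolding R
  proof (rule insert.IH)
    show "disjoint_family_on C I"
      using insert.prems(3) by (auto simp: disjoint_family_on_def)
    show "C j \<subseteq> V - C i" if "j \<in> I" for j
      using insert.prems(4)[of j] disj[OF that] that by blast
  qed (use insert.prems in auto)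
  finally show ?case
    using insert.hyps unfolding R_def[symmetric] by (simp add: mult_ac)
qed

section \<open>The number of oriented trees\<close>

lemma sum_Pow_insert:
  fixes g :: "'a set \<Rightarrow> int"
  assumes "finite V" "v \<notin> V"
  shows "(\<Sum>S\<in>Pow (insert v V). g S) = (\<Sum>S\<in>Pow V. g S + g (insert v S))"
proof -
  have "inj_on (insert v) (Pow V)"
    using assms(2) by (auto simp: inj_on_def)
  moreover have "Pow V \<inter> insert v ` Pow V = {}"
    using assms(2) by auto
  ultimately show ?thesis
    using assms(1) by (simp add: Pow_insert sum.union_disjoint sum.reindex sum.distrib)
qed

text \<open>Pairing \<open>S\<close> with \<open>insert v S\<close> replaces the power by its first
  difference, a combination of lower powers, to which the induction hypothesis for the smaller set
  applies. The sum runs over subsets instead of sizes because inclusion-exclusion produces it in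
  that form.\<close>

lemma alternating_sum_Pow_power:
  fixes a :: int
  assumes "finite V" "p < card V"
  shows "(\<Sum>S\<in>Pow V. (-1) ^ card S * (a - int (card S)) ^ p) = 0"
  using assms
proof (induction V arbitrary: a p rule: finite_induct)
  case empty
  then show ?case by simp
next
  case (insert v V)
  have card: "card (insert v S) = Suc (card S)" if "S \<in> Pow V" for S
    using that insert.hyps by (subst card_insert_disjoint) (auto intro: finite_subset)
  have expand: "x ^ p - (x - 1) ^ p = - (\<Sum>i<p. int (p choose i) * (-1) ^ (p - i) * x ^ i)" for x :: int
  proof -
    have "(x - 1) ^ p = (\<Sum>i\<le>p. int (p choose i) * (-1) ^ (p - i) * x ^ i)"
      using binomial_ring[of x "-1" p] by (simp add: mult_ac)
    then show ?thesis
      by (simp add: lessThan_Suc_atMost[symmetric])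
  qed
  have "(\<Sum>S\<in>Pow (insert v V). (-1) ^ card S * (a - int (card S)) ^ p) =
    (\<Sum>S\<in>Pow V. (-1) ^ card S * ((a - int (card S)) ^ p - (a - int (card S) - 1) ^ p))"
    unfolding sum_Pow_insert[OF insert.hyps]
    by (intro sum.cong refl) (simp add: card algebra_simps)
  also have "\<dots> = (\<Sum>S\<in>Pow V. \<Sum>i<p. - (int (p choose i) * (-1) ^ (p - i)) *
      ((-1) ^ card S * (a - int (card S)) ^ i))"
    unfolding expand by (simp add: sum_distrib_left sum_negf[symmetric] mult_ac)
  also have "\<dots> = (\<Sum>i<p. - (int (p choose i) * (-1) ^ (p - i)) *
      (\<Sum>S\<in>Pow V. (-1) ^ card S * (a - int (card S)) ^ i))"
    by (subst sum.swap) (simp add: sum_distrib_left)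
  also have "\<dots> = 0"
    using insert.IH insert.prems insert.hyps by (intro sum.neutral ballI) simp
  finally show ?case .
qed

lemma alternating_sum_Pow:
  assumes "finite L" "L \<noteq> {}"
  shows "(\<Sum>S\<in>Pow L. (-1) ^ card S :: int) = 0"
  using alternating_sum_Pow_power[of L 0 0] assms by (simp add: card_gt_0_iff)

section \<open>Leaves as attached single vertices\<close>

definition leaves :: "'a set \<Rightarrow> ('a \<times> 'a) set \<Rightarrow> 'a set" where
  "leaves V E = {v \<in> V. \<exists>d. \<exists>x \<in> V - {v}. E \<inter> touching {v} = {link d v x}}"

lemma leavesE:
  assumes "v \<in> leaves V E"
  obtains d x where "v \<in> V" "x \<in> V" "x \<noteq> v" "E \<inter> touching {v} = {link d v x}"
  using assms unfolding leaves_def by auto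

lemma closed_subset_eq:
  assumes "cut_connected V E" "D \<subseteq> V" "D \<noteq> {}" "E \<inter> touching D \<subseteq> D \<times> D"
  shows "D = V"
proof (rule ccontr)
  assume "D \<noteq> V"
  then obtain p q where "p \<in> V" "p \<in> D" "q \<in> V" "q \<notin> D"
    using assms(2,3) by blast
  then obtain a b where "(a, b) \<in> E" "(a \<in> D) \<noteq> (b \<in> D)"
    by (rule cut_connectedE[OF assms(1)])
  then show False
    using assms(4) by (auto simp: touching_def)
qed

text \<open>If two leaves \<open>v\<close> and \<open>x\<close> were adjacent, \<open>{v, x}\<close>
  would be closed and hence the whole tree, which three vertices exclude. So leaves in
  \<open>S\<close> are attached to vertices outside \<open>S\<close>, the condition that
  \<open>card_attached\<close> counts.\<close>

lemma subset_leaves_iff: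
  assumes "tree_arcs V E" "card V \<ge> 3" "S \<subseteq> V"
  shows "S \<subseteq> leaves V E \<longleftrightarrow> (\<forall>v\<in>S. attached E {v} {} (UNIV \<times> {v}) (V - S))"
proof
  assume S: "S \<subseteq> leaves V E"
  show "\<forall>v\<in>S. attached E {v} {} (UNIV \<times> {v}) (V - S)"
  proof
    fix v assume v: "v \<in> S"
    then have "v \<in> leaves V E"
      using S by blast
    then obtain d x where x: "x \<in> V" "x \<noteq> v" "E \<inter> touching {v} = {link d v x}"
      by (rule leavesE)
    have "x \<notin> S"
    proof
      assume "x \<in> S"
      then have "x \<in> leaves V E"
        using S by blast
      then obtain d' y where y: "E \<inter> touching {x} = {link d' x y}"
        by (rule leavesE)
      have "link d v x \<in> E \<inter> touching {v}"
        unfolding x(3) by simp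
      moreover have "link d v x \<in> touching {x}"
        by (simp add: touching_def link_def)
      ultimately have "link d v x \<in> E \<inter> touching {x}"
        by blast
      then have "E \<inter> touching {x} = {link d v x}"
        unfolding y by simp
      moreover have "touching {v, x} = touching {v} \<union> touching {x}"
        by (auto simp: touching_def)
      ultimately have "E \<inter> touching {v, x} \<subseteq> {v, x} \<times> {v, x}"
        by (simp add: Int_Un_distrib x(3) link_def)
      then have "{v, x} = V"
        using x(1) v assms(3)
        by (intro closed_subset_eq[OF tree_arcs_cut_connected[OF assms(1)]]) auto
      then show False
        using assms(2) x(2) by auto
    qed
    then show "attached E {v} {} (UNIV \<times> {v}) (V - S)"
      using x unfolding attached_def by blast
  qed
next
  assume "\<forall>v\<in>S. attached E {v} {} (UNIV \<times> {v}) (V - S)"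
  then show "S \<subseteq> leaves V E"
    using assms(3) by (fastforce simp: attached_def leaves_def)
qed

lemma tree_arcs_leaves_nonempty:
  assumes "tree_arcs V E" "card V \<ge> 2"
  shows "leaves V E \<noteq> {}"
proof -
  obtain d u x where "u \<in> V" "x \<in> V" "u \<noteq> x" "E \<inter> touching {u} = {link d u x}"
    by (rule tree_arcs_ex_leaf[OF assms])
  then have "u \<in> leaves V E"
    by (auto simp: leaves_def)
  then show ?thesis by blast
qed

lemma trees_empty: "trees {} = {}"
  by (auto simp: trees_def dest: tree_arcs_cut_connected cut_connected_nonempty)

lemma trees_singleton: "trees {v} = {{}}"
proof -
  have "E = {}" if "tree_arcs {v} E" for E
    using that tree_arcs_finite[OF that] by (simp add: tree_arcs_def)
  then show ?thesis
    using tree_arcs_singleton by (auto simp: trees_def)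
qed

lemma trees_doubleton:
  assumes "a \<noteq> b"
  shows "trees {a, b} = {{(a, b)}, {(b, a)}}"
proof
  show "trees {a, b} \<subseteq> {{(a, b)}, {(b, a)}}"
  proof
    fix E assume "E \<in> trees {a, b}"
    then have E: "tree_arcs {a, b} E"
      by (simp add: trees_def)
    then have "card E = 1"
      using assms by (simp add: tree_arcs_def)
    then obtain c d where cd: "E = {(c, d)}"
      by (auto simp: card_1_singleton_iff)
    then have "c \<in> {a, b}" "d \<in> {a, b}" "c \<noteq> d"
      using tree_arcs_subset[OF E] tree_arcs_antisym[OF E, of c d] by auto
    then show "E \<in> {{(a, b)}, {(b, a)}}"
      using cd by auto
  qed
  have "tree_arcs ({a} \<union> {b}) (insert (link d b a) ({} \<union> {}))" for d
    using assms by (intro tree_arcs_join tree_arcs_singleton) auto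
  from this[of True] this[of False] show "{{(a, b)}, {(b, a)}} \<subseteq> trees {a, b}"
    by (simp add: trees_def link_def insert_commute[of b a])
qed

text \<open>
  Inclusion-exclusion over the set of leaves: a prescribed set of \<open>k \<ge> 1\<close> leaves can be attached
  to a tree on the remaining \<open>m - k\<close> vertices in \<open>(2 (m - k)) ^ k\<close> ways, and the resulting
  recursion is solved by the formula because the \<open>m\<close>-th difference of a polynomial of degree
  \<open>m - 2\<close> vanishes.
\<close>

theorem card_trees:
  assumes "finite V" "V \<noteq> {}"
  shows "card (trees V) = 2 ^ (card V - 1) * card V ^ (card V - 2)"
  using assms
proof (induction "card V" arbitrary: V rule: less_induct)
  case less
  define m where "m = card V"
  have "m > 0"
    using less.prems by (simp add: m_def card_gt_0_iff)
  then consider "m = 1" | "m = 2" | "m \<ge> 3"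
    by linarith
  then show ?case
  proof cases
    case 1
    then obtain v where "V = {v}"
      by (auto simp: m_def card_1_singleton_iff)
    then show ?thesis
      by (simp add: trees_singleton)
  next
    \<comment> \<open>Handled by hand: here the two leaves are adjacent, and the equivalence of
      \<open>subset_leaves_iff\<close> fails.\<close>
    case 2
    then obtain a b where "V = {a, b}" "a \<noteq> b"
      by (auto simp: m_def card_2_iff)
    then show ?thesis
      by (auto simp: trees_doubleton card_insert_if)
  next
    case 3
    define c where "c = (\<lambda>S. card {E \<in> trees V. S \<subseteq> leaves V E})"
    \<comment> \<open>The value that the formula predicts for \<open>c S\<close>: with
      \<open>j = m - card S\<close>, the factor \<open>j ^ (j - 2)\<close> from the smaller trees
      and \<open>j ^ card S\<close> from the links combine to \<open>j ^ (m - 2)\<close>. At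
      \<open>S = {}\<close> it is the claim itself.\<close>
    define h where "h = (\<lambda>S :: 'a set. 2 ^ (m - 1) * (int m - int (card S)) ^ (m - 2))"
    have fin: "finite V" "finite (trees V)"
      using less.prems finite_trees by auto
    have finite_leaves: "finite (leaves V E)" for E
      by (rule finite_subset[OF _ fin(1)]) (auto simp: leaves_def)
    have ch: "int (c S) = h S" if S: "S \<in> Pow V" "S \<noteq> {}" for S
    proof -
      define j k where "j = card (V - S)" and "k = card S"
      have finS: "finite S"
        using S fin(1) by (auto intro: finite_subset)
      have m: "m = j + k" "k > 0"
        using S fin(1) finS by (simp_all add: j_def k_def m_def card_Diff_subset card_mono card_gt_0_iff)
      have UN: "(\<Union>v\<in>S. {v}) = S"
        by blast
      have c: "c S = card (trees (V - S)) * (2 * j) ^ k"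
      proof -
        have "c S = card {E \<in> trees V. \<forall>v\<in>S. attached E {v} {} (UNIV \<times> {v}) (V - (\<Union>v\<in>S. {v}))}"
          unfolding c_def UN using subset_leaves_iff[of V _ S] S 3
          by (intro arg_cong[where f = card] Collect_cong) (auto simp: trees_def m_def)
        also have "\<dots> = card (trees (V - S)) * (\<Prod>v\<in>S. card (UNIV \<times> {v} :: (bool \<times> 'a) set) * card (V - S))"
          by (subst card_attached[OF finS fin(1) tree_arcs_singleton])
            (use S in \<open>auto simp: disjoint_family_on_def\<close>)
        also have "\<dots> = card (trees (V - S)) * (2 * j) ^ k"
          by (simp add: card_cartesian_product j_def k_def)
        finally show ?thesis .
      qed
      show ?thesis
      \<comment> \<open>For \<open>S = V\<close> both sides are 0: there is no tree on the empty
        set, and the exponent \<open>m - 2\<close> is positive.\<close>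
      proof (cases "V - S = {}")
        case True
        then have "j = 0"
          unfolding j_def True by simp
        then show ?thesis
          using 3 m unfolding c True by (simp add: trees_empty h_def k_def[symmetric])
      next
        case False
        then have j: "j > 0"
          using fin(1) by (simp add: j_def card_gt_0_iff)
        have "card (trees (V - S)) = 2 ^ (j - 1) * j ^ (j - 2)"
          using less.hyps[of "V - S"] False fin(1) m by (simp add: j_def m_def[symmetric])
        moreover have "j ^ (j - 2) * j ^ k = j ^ (m - 2)"
        \<comment> \<open>For \<open>j = 1\<close> the truncated \<open>j - 2\<close> is 0 and the
          exponents do not add up, but all powers of 1 agree.\<close>
        proof (cases "j = 1")
          case False
          then have "j - 2 + k = m - 2"
            using j m by linarith
          then show ?thesis
            by (metis power_add)
        qed simp
        moreover have "(2::nat) ^ (j - 1) * 2 ^ k = 2 ^ (m - 1)"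
          using j m by (simp add: power_add[symmetric])
        moreover have "(p * q) * (r * s) = (p * r) * (q * s)" for p q r s :: nat
          by (simp add: mult_ac)
        ultimately have "c S = 2 ^ (m - 1) * j ^ (m - 2)"
          unfolding c power_mult_distrib by metis
        then show ?thesis
          using m by (simp add: h_def k_def[symmetric])
      qed
    qed
    \<comment> \<open>After exchanging the sums, each tree contributes an alternating sum over the
      subsets of its leaves, which vanishes because a tree has a leaf.\<close>
    have "(\<Sum>S\<in>Pow V. (-1) ^ card S * int (c S)) =
      (\<Sum>S\<in>Pow V. \<Sum>E\<in>trees V. if S \<subseteq> leaves V E then (-1) ^ card S else 0)"
      using fin(2) by (simp add: c_def sum.If_cases Int_def mult.commute)
    also have "\<dots> = (\<Sum>E\<in>trees V. \<Sum>S\<in>Pow V. if S \<subseteq> leaves V E then (-1) ^ card S else 0)"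
      by (rule sum.swap)
    also have "\<dots> = (\<Sum>E\<in>trees V. \<Sum>S\<in>Pow (leaves V E). (-1) ^ card S)"
    proof (rule sum.cong[OF refl])
      fix E
      have "Pow V \<inter> {S. S \<subseteq> leaves V E} = Pow (leaves V E)"
        by (auto simp: leaves_def)
      then show "(\<Sum>S\<in>Pow V. if S \<subseteq> leaves V E then (-1) ^ card S else 0) =
        (\<Sum>S\<in>Pow (leaves V E). (-1) ^ card S :: int)"
        using fin(1) by (simp add: sum.If_cases)
    qed
    also have "\<dots> = 0"
    proof (rule sum.neutral, rule ballI)
      fix E assume "E \<in> trees V"
      then have "leaves V E \<noteq> {}"
        using tree_arcs_leaves_nonempty[of V E] 3 by (simp add: trees_def m_def)
      then show "(\<Sum>S\<in>Pow (leaves V E). (-1) ^ card S :: int) = 0"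
        by (rule alternating_sum_Pow[OF finite_leaves])
    qed
    also have "0 = (\<Sum>S\<in>Pow V. (-1) ^ card S * h S)"
    proof -
      have "(\<Sum>S\<in>Pow V. (-1) ^ card S * h S) =
        2 ^ (m - 1) * (\<Sum>S\<in>Pow V. (-1) ^ card S * (int m - int (card S)) ^ (m - 2))"
        by (simp add: h_def sum_distrib_left mult_ac)
      also have "(\<Sum>S\<in>Pow V. (-1) ^ card S * (int m - int (card S)) ^ (m - 2)) = 0"
        using 3 by (intro alternating_sum_Pow_power fin(1)) (simp add: m_def)
      finally show ?thesis by simp
    qed
    finally have "(\<Sum>S\<in>Pow V. (-1) ^ card S * int (c S)) = (\<Sum>S\<in>Pow V. (-1) ^ card S * h S)" .
    \<comment> \<open>The two alternating sums are equal and agree term by term for nonempty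
      \<open>S\<close>. This leaves equality at \<open>S = {}\<close>, where \<open>c {}\<close>
      counts all trees.\<close>
    moreover have "(\<Sum>S\<in>Pow V - {{}}. (-1) ^ card S * int (c S)) = (\<Sum>S\<in>Pow V - {{}}. (-1) ^ card S * h S)"
      using ch by (intro sum.cong) auto
    ultimately have "int (c {}) = h {}"
      using fin(1) by (simp add: sum.remove[of "Pow V" "{}"])
    then have "int (card (trees V)) = int (2 ^ (m - 1) * m ^ (m - 2))"
      by (simp add: c_def h_def)
    then show ?thesis
      unfolding m_def of_nat_eq_iff .
  qed
qed

section \<open>Pendant stars and their moments\<close>

definition nbrs :: "('a \<times> 'a) set \<Rightarrow> 'a \<Rightarrow> 'a set" where
  "nbrs E v = {w. (v, w) \<in> E \<or> (w, v) \<in> E}"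

definition star :: "'a set \<Rightarrow> 'a \<Rightarrow> ('a \<times> 'a) set \<Rightarrow> bool" where
  "star C u F \<longleftrightarrow> u \<in> C \<and> C \<noteq> {u} \<and> F \<subseteq> C \<times> C \<and> nbrs F u = C - {u} \<and>
     (\<forall>w\<in>C - {u}. nbrs F w = {u})"

text \<open>Arc directions are forgotten, so that one analysis of overlaps serves both for two stars
  of the same pattern and for stars of different patterns.\<close>

definition star_in :: "'a set \<Rightarrow> ('a \<times> 'a) set \<Rightarrow> 'a set \<Rightarrow> 'a \<Rightarrow> 'a \<Rightarrow> bool" where
  "star_in V E C u x \<longleftrightarrow> C \<subseteq> V \<and> u \<in> C \<and> x \<in> V - C \<and> C \<noteq> {u} \<and>
     nbrs E u = insert x (C - {u}) \<and> (\<forall>w\<in>C - {u}. nbrs E w = {u})"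

lemma star_inD:
  assumes "star_in V E C u x"
  shows "C \<subseteq> V" "u \<in> C" "x \<in> V" "x \<notin> C" "C \<noteq> {u}" "nbrs E u = insert x (C - {u})"
    and star_in_leaf: "\<And>w. w \<in> C \<Longrightarrow> w \<noteq> u \<Longrightarrow> nbrs E w = {u}"
    and star_in_nbrs: "\<And>w. w \<in> C \<Longrightarrow> nbrs E w \<subseteq> insert x C"
proof -
  show *: "C \<subseteq> V" "u \<in> C" "x \<in> V" "x \<notin> C" "C \<noteq> {u}" "nbrs E u = insert x (C - {u})"
    "\<And>w. w \<in> C \<Longrightarrow> w \<noteq> u \<Longrightarrow> nbrs E w = {u}"
    using assms by (simp_all add: star_in_def)
  show "nbrs E w \<subseteq> insert x C" if "w \<in> C" for w
    using *(2,6,7) that by (cases "w = u") auto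
qed

lemma nbrs_sym: "w \<in> nbrs E v \<longleftrightarrow> v \<in> nbrs E w"
  by (auto simp: nbrs_def)

lemma nbrs_touching: "v \<in> C \<Longrightarrow> nbrs E v = nbrs (E \<inter> touching C) v"
  by (auto simp: nbrs_def touching_def)

lemma nbrs_insert_link:
  "nbrs (insert (link d u x) F) v = nbrs F v \<union> (if v = u then {x} else {}) \<union> (if v = x then {u} else {})"
  by (auto simp: nbrs_def link_def)

lemma star_star_in:
  assumes "star C u F" "E \<inter> touching C = insert (link d u x) F" "C \<subseteq> V" "x \<in> V - C"
  shows "star_in V E C u x"
proof -
  have "nbrs E v = nbrs F v \<union> (if v = u then {x} else {})" if "v \<in> C" for v
  proof -
    have "v \<noteq> x"
      using that assms(4) by blast
    then show ?thesis
      by (simp add: nbrs_touching[OF that, of E] assms(2) nbrs_insert_link)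
  qed
  then show ?thesis
    using assms by (auto simp: star_def star_in_def)
qed

lemma closed_nbrs_eq:
  assumes "cut_connected V E" "D \<subseteq> V" "D \<noteq> {}" "\<And>v. v \<in> D \<Longrightarrow> nbrs E v \<subseteq> D"
  shows "D = V"
proof (rule closed_subset_eq[OF assms(1-3)])
  show "E \<inter> touching D \<subseteq> D \<times> D"
    using assms(4) by (fastforce simp: touching_def nbrs_def)
qed

text \<open>The neighbours of \<open>u\<close> determine \<open>C\<close> once the outer neighbour
  is known. If \<open>x \<noteq> y\<close>, then \<open>x\<close> is a leaf of \<open>D\<close>, so
  \<open>insert x C\<close> is closed under neighbours and would be all of \<open>V\<close>, against
  the size of \<open>V\<close>.\<close>

lemma star_in_same_centre:
  assumes "cut_connected V E" "star_in V E C u x" "star_in V E D u y" "card C + 1 < card V"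
  shows "C = D"
proof (cases "x = y")
  case True
  then have "C - {u} = D - {u}"
    using assms(2,3) by (auto simp: star_in_def)
  then show ?thesis
    using assms(2,3) by (auto simp: star_in_def)
next
  case False
  then have "x \<in> D - {u}"
    using assms(2,3) by (auto simp: star_in_def)
  then have "nbrs E x = {u}"
    using assms(3) by (simp add: star_in_def)
  then have "nbrs E v \<subseteq> insert x C" if "v \<in> insert x C" for v
    using star_in_nbrs[OF assms(2), of v] star_inD(2)[OF assms(2)] that by auto
  then have "insert x C = V"
    using star_inD(1,3)[OF assms(2)] by (intro closed_nbrs_eq[OF assms(1)]) auto
  then have "card V \<le> card C + 1"
    using card_insert_le_m1[of "card C + 1" C x] by auto
  then show ?thesis
    using assms(4) by simp
qed

text \<open>A centre has at least two neighbours, a leaf of its star and its outer neighbour, so it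
  is not a leaf of the other star; and a leaf determines its centre. The only contact left is an arc
  between the centres, but then \<open>C \<union> D\<close> would be closed and hence all of
  \<open>V\<close>. The claims on \<open>x\<close> and \<open>y\<close> place both attachments in
  the common remainder.\<close>

lemma star_in_distinct_centres:
  assumes "cut_connected V E" "star_in V E C u x" "star_in V E D v y" "u \<noteq> v"
    "card C + card D < card V"
  shows "C \<inter> D = {}" "x \<notin> D" "y \<notin> C"
proof -
  have notin: "v' \<notin> C'"
    if C': "star_in V E C' u' x'" and D': "star_in V E D' v' y'" and "u' \<noteq> v'" for C' D' u' v' x' y'
  proof
    assume "v' \<in> C'"
    then have "nbrs E v' = {u'}"
      using C' \<open>u' \<noteq> v'\<close> by (simp add: star_in_def)
    moreover obtain w where w: "w \<in> D'" "w \<noteq> v'"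
      using D' unfolding star_in_def by blast
    then have "w \<in> nbrs E v'" "y' \<in> nbrs E v'" "w \<noteq> y'"
      using D' unfolding star_in_def by auto
    ultimately show False
      by simp
  qed
  have uv: "v \<notin> C" "u \<notin> D"
    using notin[OF assms(2,3)] notin[OF assms(3,2)] assms(4) by auto
  show disj: "C \<inter> D = {}"
  proof (rule equals0I)
    fix w assume w: "w \<in> C \<inter> D"
    then have "w \<in> C - {u}" "w \<in> D - {v}"
      using uv by auto
    then have "nbrs E w = {u}" "nbrs E w = {v}"
      using star_in_leaf[OF assms(2)] star_in_leaf[OF assms(3)] by blast+
    then show False
      using assms(4) by simp
  qed
  have not_joined: False if xy: "x = v" "y = u"
  proof -
    have "nbrs E w \<subseteq> C \<union> D" if "w \<in> C \<union> D" for w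
      using that xy star_in_nbrs[OF assms(2), of w] star_in_nbrs[OF assms(3), of w]
        star_inD(2)[OF assms(2)] star_inD(2)[OF assms(3)] by blast
    then have "C \<union> D = V"
      using star_inD(1,2)[OF assms(2)] star_inD(1)[OF assms(3)]
      by (intro closed_nbrs_eq[OF assms(1)]) auto
    then show False
      using card_Un_le[of C D] assms(5) by simp
  qed
  \<comment> \<open>An outer neighbour \<open>x'\<close> inside the other star is adjacent to
    \<open>u'\<close>, which lies outside that star. Only the centre of a star has such a neighbour,
    so the two centres are joined.\<close>
  have centre: "x' = v' \<and> y' = u'"
    if "star_in V E C' u' x'" "star_in V E D' v' y'" "u' \<noteq> v'" "u' \<notin> D'" "x' \<in> D'" for C' D' u' v' x' y'
  proof -
    have u: "u' \<in> nbrs E x'"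
      unfolding nbrs_sym[of u'] star_inD(6)[OF that(1)] by simp
    then have "x' = v'"
      using star_in_leaf[OF that(2,5)] that(3) by auto
    then show ?thesis
      using u that(4) star_inD(6)[OF that(2)] by auto
  qed
  show "x \<notin> D"
    using centre[OF assms(2,3,4) uv(2)] not_joined by blast
  show "y \<notin> C"
    using centre[OF assms(3,2) _ uv(1)] assms(4) not_joined by blast
qed

section \<open>Lists of distinct vertices\<close>

definition tuples :: "nat \<Rightarrow> 'a set \<Rightarrow> 'a list set" where
  "tuples r V = {xs. length xs = r \<and> distinct xs \<and> set xs \<subseteq> V}"

lemma finite_tuples: "finite V \<Longrightarrow> finite (tuples r V)"
  by (rule finite_subset[OF _ finite_lists_length_eq[of V r]]) (auto simp: tuples_def)

lemma card_tuples:
  assumes "finite V" "r \<le> card V"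
  shows "card (tuples r V) = \<Prod>{card V - r + 1..card V}"
  using card_lists_distinct_length_eq[OF assms] by (simp add: tuples_def)

lemma card_disjoint_tuples:
  assumes "finite V" "2 * r \<le> card V"
  shows "card {(xs, ys). xs \<in> tuples r V \<and> ys \<in> tuples r V \<and> set xs \<inter> set ys = {}} =
    \<Prod>{card V - 2 * r + 1..card V}"
proof -
  have "bij_betw (\<lambda>(xs, ys). xs @ ys)
    {(xs, ys). xs \<in> tuples r V \<and> ys \<in> tuples r V \<and> set xs \<inter> set ys = {}} (tuples (2 * r) V)"
  proof (rule bij_betw_byWitness[where f' = "\<lambda>zs. (take r zs, drop r zs)"])
    show "(\<lambda>zs. (take r zs, drop r zs)) ` tuples (2 * r) V \<subseteq>
      {(xs, ys). xs \<in> tuples r V \<and> ys \<in> tuples r V \<and> set xs \<inter> set ys = {}}"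
    proof (rule image_subsetI)
      fix zs assume "zs \<in> tuples (2 * r) V"
      then have zs: "length zs = 2 * r" "distinct zs" "set zs \<subseteq> V"
        by (auto simp: tuples_def)
      have "set (take r zs) \<inter> set (drop r zs) = {}"
        by (rule set_take_disj_set_drop_if_distinct[OF zs(2)]) simp
      moreover have "set (take r zs) \<subseteq> V" "set (drop r zs) \<subseteq> V"
        using zs(3) set_take_subset[of r zs] set_drop_subset[of r zs] by (auto dest: subsetD)
      ultimately show "(take r zs, drop r zs) \<in>
        {(xs, ys). xs \<in> tuples r V \<and> ys \<in> tuples r V \<and> set xs \<inter> set ys = {}}"
        using zs(1,2) by (simp add: tuples_def)
    qed
  qed (auto simp: tuples_def)
  then show ?thesis
    unfolding card_tuples[OF assms, symmetric] by (rule bij_betw_same_card)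
qed

text \<open>
  An occurrence of a star is encoded as the list of its vertices, centre first; \<open>inj\<close> says that
  the arcs and the centre determine the list, so that no star is counted twice.
\<close>

locale star_pattern =
  fixes r :: nat and F :: "'a list \<Rightarrow> ('a \<times> 'a) set" and d :: bool
  assumes star: "\<And>xs. length xs = r \<Longrightarrow> distinct xs \<Longrightarrow> star (set xs) (hd xs) (F xs)"
    and tree: "\<And>xs. length xs = r \<Longrightarrow> distinct xs \<Longrightarrow> tree_arcs (set xs) (F xs)"
    and inj: "\<And>xs ys. length xs = r \<Longrightarrow> length ys = r \<Longrightarrow> distinct xs \<Longrightarrow> distinct ys \<Longrightarrow>
      hd xs = hd ys \<Longrightarrow> F xs = F ys \<Longrightarrow> xs = ys"
begin

abbreviation att :: "('a \<times> 'a) set \<Rightarrow> 'a set \<Rightarrow> 'a list \<Rightarrow> bool" where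
  "att E R xs \<equiv> attached E (set xs) (F xs) {(d, hd xs)} R"

definition occ :: "'a set \<Rightarrow> ('a \<times> 'a) set \<Rightarrow> 'a list set" where
  "occ V E = {xs \<in> tuples r V. att E (V - set xs) xs}"

lemma attE:
  assumes "att E R xs" "xs \<in> tuples r V" "R \<subseteq> V - set xs"
  obtains x where "x \<in> R" "E \<inter> touching (set xs) = insert (link d (hd xs) x) (F xs)"
    "star_in V E (set xs) (hd xs) x"
proof -
  obtain x where x: "x \<in> R" "E \<inter> touching (set xs) = insert (link d (hd xs) x) (F xs)"
    using assms(1) by (auto simp: attached_def)
  moreover have "star_in V E (set xs) (hd xs) x"
    using assms(2,3) x(1) by (intro star_star_in[OF star x(2)]) (auto simp: tuples_def)
  ultimately show ?thesis
    using that by blast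
qed

lemma hd_in: "xs \<in> tuples r (V :: 'a set) \<Longrightarrow> hd xs \<in> set xs"
  using star[of xs] by (auto simp: tuples_def star_def)

lemma finite_occ: "finite V \<Longrightarrow> finite (occ V E)"
  by (rule finite_subset[OF _ finite_tuples[of V r]]) (auto simp: occ_def)

lemma card_att:
  assumes "finite V" "I \<subseteq> tuples r V" "finite I" "disjoint_family_on set I"
  shows "card {E \<in> trees V. \<forall>xs\<in>I. att E (V - \<Union> (set ` I)) xs} =
    card (trees (V - \<Union> (set ` I))) * card (V - \<Union> (set ` I)) ^ card I"
  using assms(2) hd_in by (subst card_attached[OF assms(3,1) tree assms(4)]) (auto simp: tuples_def)

text \<open>Double counting: for each list, the number of trees in which it occurs is given by
  \<open>card_att\<close> and depends only on \<open>card V\<close> and \<open>r\<close>.\<close>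

lemma sum_card_occ:
  assumes "finite V" "r < card V"
  shows "(\<Sum>E\<in>trees V. card (occ V E)) =
    \<Prod>{card V - r + 1..card V} * (2 ^ (card V - r - 1) * (card V - r) ^ (card V - r - 2)) * (card V - r)"
proof -
  have "(\<Sum>E\<in>trees V. card (occ V E)) = (\<Sum>E\<in>trees V. \<Sum>xs\<in>tuples r V. of_bool (att E (V - set xs) xs))"
    using finite_tuples[OF assms(1)] by (intro sum.cong refl) (simp add: occ_def Int_def)
  also have "\<dots> = (\<Sum>xs\<in>tuples r V. \<Sum>E\<in>trees V. of_bool (att E (V - set xs) xs))"
    by (rule sum.swap)
  also have "\<dots> = (\<Sum>xs\<in>tuples r V. 2 ^ (card V - r - 1) * (card V - r) ^ (card V - r - 2) * (card V - r))"
  proof (rule sum.cong[OF refl])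
    fix xs assume xs: "xs \<in> tuples r V"
    then have card: "card (V - set xs) = card V - r"
      by (auto simp: tuples_def card_Diff_subset distinct_card)
    moreover have "V - set xs \<noteq> {}"
      using card assms(2) by (metis card.empty diff_is_0_eq not_less)
    moreover have "(\<Sum>E\<in>trees V. of_bool (att E (V - set xs) xs)) =
      card {E \<in> trees V. \<forall>ys\<in>{xs}. att E (V - \<Union> (set ` {xs})) ys}"
      using finite_trees[OF assms(1)] by (simp add: Int_def)
    moreover have "card {E \<in> trees V. \<forall>ys\<in>{xs}. att E (V - \<Union> (set ` {xs})) ys} =
      card (trees (V - \<Union> (set ` {xs}))) * card (V - \<Union> (set ` {xs})) ^ card {xs}"
      using xs by (intro card_att assms(1)) (auto simp: disjoint_family_on_def)
    ultimately show "(\<Sum>E\<in>trees V. of_bool (att E (V - set xs) xs)) =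
      2 ^ (card V - r - 1) * (card V - r) ^ (card V - r - 2) * (card V - r)"
      using assms(1) by (simp add: card_trees)
  qed
  also have "\<dots> = \<Prod>{card V - r + 1..card V} * (2 ^ (card V - r - 1) * (card V - r) ^ (card V - r - 2)) * (card V - r)"
    using assms by (simp add: card_tuples)
  finally show ?thesis .
qed

text \<open>Reduces the second moment to an exact count: two distinct occurrences are two gluings
  onto the same remainder. Equal centres would force equal vertex sets, then equal inner arcs, and
  by \<open>inj\<close> equal lists; distinct centres fall under
  \<open>star_in_distinct_centres\<close>.\<close>

lemma occ_pairs:
  assumes "finite V" "2 * r < card V" "tree_arcs V E"
  shows "xs \<in> occ V E \<and> ys \<in> occ V E \<and> xs \<noteq> ys \<longleftrightarrow>
    (xs \<in> tuples r V \<and> ys \<in> tuples r V \<and> set xs \<inter> set ys = {}) \<and>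
    att E (V - (set xs \<union> set ys)) xs \<and> att E (V - (set xs \<union> set ys)) ys"
    (is "?L \<longleftrightarrow> ?R")
proof
  assume L: ?L
  then have t: "xs \<in> tuples r V" "ys \<in> tuples r V"
    by (auto simp: occ_def)
  obtain x where x: "x \<in> V - set xs" "E \<inter> touching (set xs) = insert (link d (hd xs) x) (F xs)"
      "star_in V E (set xs) (hd xs) x"
    using L t by (auto simp: occ_def elim: attE)
  obtain y where y: "y \<in> V - set ys" "E \<inter> touching (set ys) = insert (link d (hd ys) y) (F ys)"
      "star_in V E (set ys) (hd ys) y"
    using L t by (auto simp: occ_def elim: attE)
  have cc: "cut_connected V E"
    by (rule tree_arcs_cut_connected[OF assms(3)])
  have cards: "card (set xs) = r" "card (set ys) = r"
    using t by (auto simp: tuples_def distinct_card)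
  have "hd xs \<noteq> hd ys"
  proof
    assume hd: "hd xs = hd ys"
    have "r > 0"
      using hd_in[OF t(1)] t by (auto simp: tuples_def)
    then have eq: "set xs = set ys"
      using star_in_same_centre[OF cc x(3) y(3)[folded hd]] cards assms(2) by simp
    \<comment> \<open>The inner arcs are those arcs at the star that have both ends in it, because
      the link has an end outside.\<close>
    have F: "F zs = E \<inter> touching (set zs) \<inter> set zs \<times> set zs"
      if "zs \<in> tuples r V" "z \<notin> set zs" "E \<inter> touching (set zs) = insert (link d (hd zs) z) (F zs)" for zs z
      using that(2) tree_arcs_subset[OF tree[of zs]] that(1) unfolding that(3)
      by (auto simp: tuples_def link_def)
    have "F xs = F ys"
      using F[OF t(1) _ x(2)] F[OF t(2) _ y(2)] x(1) y(1) eq by simp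
    then show False
      using L inj[of xs ys] hd t by (simp add: tuples_def)
  qed
  then have "set xs \<inter> set ys = {}" "x \<notin> set ys" "y \<notin> set xs"
    using star_in_distinct_centres[OF cc x(3) y(3)] cards assms(2) by auto
  then show ?R
    using t x(1,2) y(1,2) by (auto simp: attached_def)
next
  assume R: ?R
  then have "xs \<in> occ V E" "ys \<in> occ V E"
    by (auto simp: occ_def attached_def)
  moreover have "xs \<noteq> ys"
    using R hd_in[of xs V] by auto
  ultimately show ?L by blast
qed

text \<open>The factorial moment counts ordered pairs of distinct occurrences, so the diagonal never
  enters the double count.\<close>

lemma sum_card_occ_pairs:
  assumes "finite V" "2 * r < card V"
  shows "(\<Sum>E\<in>trees V. card (occ V E) * (card (occ V E) - 1)) =
    \<Prod>{card V - 2 * r + 1..card V} *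
      (2 ^ (card V - 2 * r - 1) * (card V - 2 * r) ^ (card V - 2 * r - 2)) * (card V - 2 * r)\<^sup>2"
proof -
  define P where "P = {(xs, ys). xs \<in> tuples r V \<and> ys \<in> tuples r V \<and> set xs \<inter> set ys = {}}"
  define Q where "Q = (\<lambda>E (xs, ys). att E (V - (set xs \<union> set ys)) xs \<and> att E (V - (set xs \<union> set ys)) ys)"
  define c where "c = 2 ^ (card V - 2 * r - 1) * (card V - 2 * r) ^ (card V - 2 * r - 2) * (card V - 2 * r)\<^sup>2"
  have finP: "finite P"
    by (rule finite_subset[of _ "tuples r V \<times> tuples r V"]) (auto simp: P_def finite_tuples assms(1))
  have "card (occ V E) * (card (occ V E) - 1) = (\<Sum>p\<in>P. of_bool (Q E p))" if "E \<in> trees V" for E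
  proof -
    have "(occ V E \<times> occ V E) - (\<lambda>xs. (xs, xs)) ` occ V E = {p \<in> P. Q E p}"
      using occ_pairs[OF assms, of E] that by (auto simp: P_def Q_def trees_def)
    moreover have "card ((occ V E \<times> occ V E) - (\<lambda>xs. (xs, xs)) ` occ V E) =
      card (occ V E) * card (occ V E) - card (occ V E)"
      using finite_occ[OF assms(1), of E]
      by (subst card_Diff_subset) (auto simp: card_cartesian_product card_image inj_on_def)
    ultimately show ?thesis
      using finP by (simp add: Int_def diff_mult_distrib2)
  qed
  then have "(\<Sum>E\<in>trees V. card (occ V E) * (card (occ V E) - 1)) =
    (\<Sum>E\<in>trees V. \<Sum>p\<in>P. of_bool (Q E p))"
    by simp
  also have "\<dots> = (\<Sum>p\<in>P. \<Sum>E\<in>trees V. of_bool (Q E p))"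
    by (rule sum.swap)
  also have "\<dots> = (\<Sum>p\<in>P. c)"
  proof (rule sum.cong[OF refl])
    fix p assume "p \<in> P"
    then obtain xs ys where p: "p = (xs, ys)" "xs \<in> tuples r V" "ys \<in> tuples r V" "set xs \<inter> set ys = {}"
      by (auto simp: P_def)
    define R where "R = V - \<Union> (set ` {xs, ys})"
    have "xs \<noteq> ys"
      using p hd_in[of xs V] by auto
    have "card (set xs \<union> set ys) = 2 * r"
      using p by (subst card_Un_disjoint) (auto simp: tuples_def distinct_card)
    then have card: "card R = card V - 2 * r"
      using p unfolding R_def by (subst card_Diff_subset) (auto simp: tuples_def)
    then have "card R \<noteq> 0"
      using assms(2) by simp
    then have R: "R \<noteq> {}" "finite R"
      using assms(1) by (auto simp: R_def)
    have "(\<Sum>E\<in>trees V. of_bool (Q E p)) = card {E \<in> trees V. \<forall>zs\<in>{xs, ys}. att E R zs}"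
      using finite_trees[OF assms(1)] by (simp add: Int_def Q_def p(1) R_def)
    also have "\<dots> = card (trees R) * card R ^ card {xs, ys}"
      unfolding R_def using p assms(1) by (intro card_att) (auto simp: disjoint_family_on_def)
    also have "\<dots> = c"
      using \<open>xs \<noteq> ys\<close> by (simp add: card_trees[OF R(2,1)] card c_def power2_eq_square)
    finally show "(\<Sum>E\<in>trees V. of_bool (Q E p)) = c" .
  qed
  also have "\<dots> = card P * c"
    by simp
  also have "card P = \<Prod>{card V - 2 * r + 1..card V}"
    unfolding P_def using assms by (intro card_disjoint_tuples) auto
  finally show ?thesis
    by (simp add: c_def mult.assoc)
qed

end

section \<open>Asymptotics\<close>

definition ntrees :: "nat \<Rightarrow> real" where
  "ntrees n = 2 ^ (n - 1) * real n ^ (n - 2)"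

text \<open>A form suited to asymptotic expansion, with real exponents; \<open>r + 2 \<le> n\<close>
  makes the truncated subtractions exact.\<close>

lemma ntrees_ratio:
  assumes "r + 2 \<le> n"
  shows "ntrees (n - r) / ntrees n =
    (real n - real r) powr (real n - real r - 2) / real n powr (real n - 2) / 2 ^ r"
proof -
  have "n - 1 = (n - r - 1) + r"
    using assms by simp
  then have "(2 :: real) ^ (n - 1) = 2 ^ (n - r - 1) * 2 ^ r"
    by (simp only: power_add)
  then show ?thesis
    using assms by (simp add: ntrees_def powr_realpow[symmetric] of_nat_diff diff_diff_eq add.commute)
qed

text \<open>Chebyshev's inequality for the uniform distribution on \<open>A\<close>:
  \<open>b\<close> is the second factorial moment, so \<open>b + a - a\<^sup>2\<close> is the
  variance.\<close>

lemma lower_tail_bound: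
  fixes f :: "'a \<Rightarrow> nat"
  assumes "finite A" "A \<noteq> {}" and a: "a = real (\<Sum>x\<in>A. f x) / card A"
    and b: "b = real (\<Sum>x\<in>A. f x * (f x - 1)) / card A" and "t < a"
  shows "card {x \<in> A. real (f x) \<le> t} / card A \<le> (b + a - a\<^sup>2) / (a - t)\<^sup>2"
proof -
  have card: "card A > 0"
    using assms(1,2) by (simp add: card_gt_0_iff)
  have sq: "real (f x * (f x - 1)) = (real (f x))\<^sup>2 - real (f x)" for x
    by (cases "f x") (simp_all add: power2_eq_square algebra_simps)
  have "(a - t)\<^sup>2 * card {x \<in> A. real (f x) \<le> t} = (\<Sum>x | x \<in> A \<and> real (f x) \<le> t. (a - t)\<^sup>2)"
    by simp
  also have "\<dots> \<le> (\<Sum>x | x \<in> A \<and> real (f x) \<le> t. (a - real (f x))\<^sup>2)"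
    using assms(5) by (intro sum_mono power_mono) auto
  also have "\<dots> \<le> (\<Sum>x\<in>A. (a - real (f x))\<^sup>2)"
    using assms(1) by (intro sum_mono2) auto
  also have "\<dots> = (\<Sum>x\<in>A. a\<^sup>2 - 2 * a * real (f x) + (real (f x * (f x - 1)) + real (f x)))"
    unfolding sq by (simp add: power2_diff algebra_simps)
  also have "\<dots> = card A * a\<^sup>2 - 2 * a * real (\<Sum>x\<in>A. f x) +
      (real (\<Sum>x\<in>A. f x * (f x - 1)) + real (\<Sum>x\<in>A. f x))"
    by (simp only: sum.distrib sum_subtractf sum_distrib_left[symmetric] sum_constant of_nat_sum)
  also have "\<dots> = card A * (b + a - a\<^sup>2)"
    using card unfolding a b by (simp add: field_simps power2_eq_square)
  finally show ?thesis
    using card assms(5) by (simp add: field_simps)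
qed

lemma prod_atLeastAtMost_falling:
  assumes "r \<le> n"
  shows "real (\<Prod>{n - r + 1..n}) = (\<Prod>i<r. real n - real i)"
  using assms
proof (induction r)
  case (Suc r)
  have "{n - Suc r + 1..n} = insert (n - r) {n - r + 1..n}"
    using Suc.prems by auto
  then show ?case
    using Suc by (simp add: of_nat_diff mult.commute)
qed simp

context star_pattern
begin

definition mean :: "nat \<Rightarrow> real" where
  "mean n = (\<Prod>i<r. real n - real i) * real (n - r) * (ntrees (n - r) / ntrees n)"

definition pair_mean :: "nat \<Rightarrow> real" where
  "pair_mean n =
     (\<Prod>i<2 * r. real n - real i) * (real (n - 2 * r))\<^sup>2 * (ntrees (n - 2 * r) / ntrees n)"

lemma mean_eq:
  assumes "finite V" "r < card V"
  shows "real (\<Sum>E\<in>trees V. card (occ V E)) / card (trees V) = mean (card V)"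
proof -
  have "V \<noteq> {}"
    using assms by auto
  then show ?thesis
    using assms prod_atLeastAtMost_falling[of r "card V"]
    unfolding sum_card_occ[OF assms] by (simp add: card_trees mean_def ntrees_def of_nat_diff)
qed

lemma pair_mean_eq:
  assumes "finite V" "2 * r < card V"
  shows "real (\<Sum>E\<in>trees V. card (occ V E) * (card (occ V E) - 1)) / card (trees V) = pair_mean (card V)"
proof -
  have "V \<noteq> {}"
    using assms by auto
  then show ?thesis
    using assms prod_atLeastAtMost_falling[of "2 * r" "card V"]
    unfolding sum_card_occ_pairs[OF assms] by (simp add: card_trees pair_mean_def ntrees_def of_nat_diff)
qed

lemma few_occ:
  fixes V :: "nat \<Rightarrow> 'a set" and q c :: real
  assumes "(\<lambda>n. mean n / n) \<longlonglongrightarrow> c" "(\<lambda>n. pair_mean n / n\<^sup>2) \<longlonglongrightarrow> c\<^sup>2" "q < c"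
    and V: "\<And>n. finite (V n)" "\<And>n. card (V n) = n"
  shows "(\<lambda>n. card {E \<in> trees (V n). real (card (occ (V n) E)) \<le> q * n} / card (trees (V n))) \<longlonglongrightarrow> 0"
proof -
  \<comment> \<open>The Chebyshev bound with numerator and denominator divided by
    \<open>n\<^sup>2\<close>. In the limit the numerator becomes
    \<open>c\<^sup>2 - c\<^sup>2\<close>, while the denominator stays away from 0 because
    \<open>q < c\<close>.\<close>
  define g where "g = (\<lambda>n. (pair_mean n / n\<^sup>2 + mean n / n * (1 / real n) - (mean n / n)\<^sup>2) / (mean n / n - q)\<^sup>2)"
  have "g \<longlonglongrightarrow> (c\<^sup>2 + c * 0 - c\<^sup>2) / (c - q)\<^sup>2"
    unfolding g_def using assms(3) lim_1_over_n[where 'a = real]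
    by (intro tendsto_intros assms(1,2)) auto
  then have g: "g \<longlonglongrightarrow> 0"
    by simp
  show ?thesis
  proof (rule tendsto_sandwich[OF _ _ tendsto_const g])
    have "eventually (\<lambda>n. mean n / n > q) sequentially"
      using order_tendstoD(1)[OF assms(1,3)] .
    then show "eventually (\<lambda>n. card {E \<in> trees (V n). real (card (occ (V n) E)) \<le> q * n} / card (trees (V n)) \<le> g n) sequentially"
      using eventually_gt_at_top[of "2 * r"]
    proof eventually_elim
      case (elim n)
      have n: "n > 0"
        using elim(2) by simp
      then have ne: "V n \<noteq> {}"
        using V[of n] by auto
      have "card (trees (V n)) > 0"
        using n V[of n] ne by (simp add: card_trees)
      then have ne': "trees (V n) \<noteq> {}"
        by auto
      have "q * n < mean n"
        using elim(1) n by (simp add: field_simps)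
      then have "card {E \<in> trees (V n). real (card (occ (V n) E)) \<le> q * n} / card (trees (V n)) \<le>
        (pair_mean n + mean n - (mean n)\<^sup>2) / (mean n - q * n)\<^sup>2"
        using elim(2) V[of n] mean_eq[of "V n"] pair_mean_eq[of "V n"]
        by (intro lower_tail_bound[OF finite_trees[OF V(1)] ne']) simp_all
      also have "\<dots> = g n"
      proof -
        have "mean n - q * n = n * (mean n / n - q)"
          using n by (simp add: field_simps)
        moreover have "pair_mean n + mean n - (mean n)\<^sup>2 =
          n\<^sup>2 * (pair_mean n / n\<^sup>2 + mean n / n * (1 / real n) - (mean n / n)\<^sup>2)"
          using n by (simp add: field_simps power2_eq_square)
        ultimately show ?thesis
          using n by (simp add: g_def power_mult_distrib)
      qed
      finally show ?case .
    qed
  qed simp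
qed

end

lemma prod_falling:
  "(\<Prod>i<2. x - real i) = x * (x - 1)"
  "(\<Prod>i<3. x - real i) = x * (x - 1) * (x - 2)"
  "(\<Prod>i<4. x - real i) = x * (x - 1) * (x - 2) * (x - 3)"
  "(\<Prod>i<6. x - real i) = x * (x - 1) * (x - 2) * (x - 3) * (x - 4) * (x - 5)"
  by (simp_all add: eval_nat_numeral)

text \<open>For a star with \<open>r\<close> vertices the mean is asymptotic to
  \<open>n * (1 - r / n) ^ n / 2 ^ r\<close>, which gives the limit \<open>exp (- r) / 2 ^ r\<close>
  after division by \<open>n\<close>. A pair removes \<open>2 * r\<close> vertices and has two
  links, and its limit is the square of this: hence the small variance.\<close>

lemma ntrees_limits:
  "(\<lambda>n. (\<Prod>i<2. real n - real i) * real (n - 2) * (ntrees (n - 2) / ntrees n) / n)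
    \<longlonglongrightarrow> exp (-2) / 4" (is ?A)
  "(\<lambda>n. (\<Prod>i<4. real n - real i) * (real (n - 4))\<^sup>2 * (ntrees (n - 4) / ntrees n) / n\<^sup>2)
    \<longlonglongrightarrow> (exp (-2) / 4)\<^sup>2" (is ?AA)
  "(\<lambda>n. (\<Prod>i<3. real n - real i) * real (n - 3) * (ntrees (n - 3) / ntrees n) / n)
    \<longlonglongrightarrow> exp (-3) / 8" (is ?B)
  "(\<lambda>n. (\<Prod>i<6. real n - real i) * (real (n - 6))\<^sup>2 * (ntrees (n - 6) / ntrees n) / n\<^sup>2)
    \<longlonglongrightarrow> (exp (-3) / 8)\<^sup>2" (is ?BB)
proof -
  \<comment> \<open>8 is 6 + 2, as \<open>ntrees_ratio\<close> is applied with up to 6 removed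
    vertices.\<close>
  have large: "eventually (\<lambda>n. n \<ge> (8 :: nat)) sequentially"
    by (rule eventually_ge_at_top)
  have "(\<lambda>n. (real n * (real n - 1)) * (real n - 2) *
      ((real n - 2) powr (real n - 2 - 2) / real n powr (real n - 2) / 4) / n) \<longlonglongrightarrow> exp (-2) / 4"
    by (real_asymp simp: exp_minus)
  then show ?A
    by (rule Lim_transform_eventually, intro eventually_mono[OF large])
      (simp add: ntrees_ratio prod_falling of_nat_diff)
  have "(\<lambda>n. (real n * (real n - 1) * (real n - 2) * (real n - 3)) * (real n - 4)\<^sup>2 *
      ((real n - 4) powr (real n - 4 - 2) / real n powr (real n - 2) / 16) / n\<^sup>2) \<longlonglongrightarrow> exp (-4) / 16"
    by (real_asymp simp: exp_minus)
  also have "exp (-4) / 16 = (exp (-2) / 4 :: real)\<^sup>2"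
    by (simp add: power2_eq_square exp_add[symmetric])
  finally show ?AA
    by (rule Lim_transform_eventually, intro eventually_mono[OF large])
      (simp add: ntrees_ratio prod_falling of_nat_diff)
  have "(\<lambda>n. (real n * (real n - 1) * (real n - 2)) * (real n - 3) *
      ((real n - 3) powr (real n - 3 - 2) / real n powr (real n - 2) / 8) / n) \<longlonglongrightarrow> exp (-3) / 8"
    by (real_asymp simp: exp_minus)
  then show ?B
    by (rule Lim_transform_eventually, intro eventually_mono[OF large])
      (simp add: ntrees_ratio prod_falling of_nat_diff)
  have "(\<lambda>n. (real n * (real n - 1) * (real n - 2) * (real n - 3) * (real n - 4) * (real n - 5)) * (real n - 6)\<^sup>2 *
      ((real n - 6) powr (real n - 6 - 2) / real n powr (real n - 2) / 64) / n\<^sup>2) \<longlonglongrightarrow> exp (-6) / 64"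
    by (real_asymp simp: exp_minus)
  also have "exp (-6) / 64 = (exp (-3) / 8 :: real)\<^sup>2"
    by (simp add: power2_eq_square exp_add[symmetric])
  finally show ?BB
    by (rule Lim_transform_eventually, intro eventually_mono[OF large])
      (simp add: ntrees_ratio prod_falling of_nat_diff)
qed

section \<open>Niceness\<close>

abbreviation digraph_of :: "'a set \<Rightarrow> ('a \<times> 'a) set \<Rightarrow> 'a pair_pre_digraph" where
  "digraph_of V E \<equiv> \<lparr>pverts = V, parcs = E\<rparr>"

lemma oriented_tree_wf: "oriented_tree T \<Longrightarrow> wf_digraph (with_proj T)"
  by (simp add: wf_digraph_wp_iff oriented_tree_def pair_digraph_def pair_fin_digraph_def)

text \<open>A single neighbour could still contribute to both degrees; the absence of opposite arcs
  leaves exactly one arc.\<close>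

lemma leafI:
  assumes "tree_arcs V E" "v \<in> V" "nbrs E v = {u}"
  shows "leaf (digraph_of V E) v"
proof -
  have arcs: "in_arcs (with_proj (digraph_of V E)) v = {e \<in> E. snd e = v}"
    "out_arcs (with_proj (digraph_of V E)) v = {e \<in> E. fst e = v}"
    by (auto simp: in_arcs_def out_arcs_def)
  have nbrs: "(v, w) \<in> E \<or> (w, v) \<in> E \<longleftrightarrow> w = u" for w
    using assms(3) by (simp add: nbrs_def set_eq_iff)
  have sub: "{e \<in> E. snd e = v} \<subseteq> {(u, v)}" "{e \<in> E. fst e = v} \<subseteq> {(v, u)}"
  proof -
    have "(w, v) \<in> E \<Longrightarrow> w = u" "(v, w) \<in> E \<Longrightarrow> w = u" for w
      using nbrs[of w] by simp_all
    then show "{e \<in> E. snd e = v} \<subseteq> {(u, v)}" "{e \<in> E. fst e = v} \<subseteq> {(v, u)}"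
      by auto
  qed
  have "(u, v) \<in> E \<or> (v, u) \<in> E"
    using nbrs[of u] by blast
  then consider "(u, v) \<in> E" "(v, u) \<notin> E" | "(v, u) \<in> E" "(u, v) \<notin> E"
    using tree_arcs_antisym[OF assms(1)] by metis
  then show ?thesis
  proof cases
    case 1
    then have "{e \<in> E. snd e = v} = {(u, v)}" "{e \<in> E. fst e = v} = {}"
      using sub by auto
    note eqs = this
    show ?thesis
      unfolding leaf_def in_degree_def out_degree_def arcs eqs using assms(2) by simp
  next
    case 2
    then have "{e \<in> E. snd e = v} = {}" "{e \<in> E. fst e = v} = {(v, u)}"
      using sub by auto
    note eqs = this
    show ?thesis
      unfolding leaf_def in_degree_def out_degree_def arcs eqs using assms(2) by simp
  qed
qed

context star_pattern
begin

context
  fixes V :: "'a set" and E xs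
  assumes E: "tree_arcs V E" and xs: "xs \<in> occ V E"
begin

lemma pattern: "length xs = r" "distinct xs" "set xs \<subseteq> V"
  using xs by (auto simp: occ_def tuples_def)

lemma pattern_arcs: "F xs \<subseteq> E"
  using xs by (auto simp: occ_def attached_def)

lemma pattern_star_in:
  obtains x where "E \<inter> touching (set xs) = insert (link d (hd xs) x) (F xs)"
    "star_in V E (set xs) (hd xs) x"
proof -
  have "att E (V - set xs) xs" "xs \<in> tuples r V"
    using xs by (simp_all add: occ_def)
  then show ?thesis
    by (rule attE[OF _ _ subset_refl]) (rule that)
qed

text \<open>Detaching the star leaves a tree on the other vertices, which gives the connected
  complement.\<close>

lemma pattern_pendant: "pendant (digraph_of (set xs) (F xs)) (digraph_of V E)"
proof -
  obtain x where x: "E \<inter> touching (set xs) = insert (link d (hd xs) x) (F xs)"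
    "star_in V E (set xs) (hd xs) x"
    by (rule pattern_star_in)
  have S: "tree_arcs (set xs) (F xs)"
    by (rule tree[OF pattern(1,2)])
  have trees: "oriented_tree (digraph_of (set xs) (F xs))" "oriented_tree (digraph_of V E)"
    using S E by (simp_all add: oriented_tree_iff_tree_arcs)
  have "subgraph (with_proj (digraph_of (set xs) (F xs))) (with_proj (digraph_of V E))"
    unfolding subgraph_def compatible_def
    using pattern(3) pattern_arcs trees[THEN oriented_tree_wf] by simp
  moreover have "tree_arcs (V - set xs) (E - touching (set xs))"
    using star_inD[OF x(2)] by (intro tree_arcs_detach[OF E S _ _ _ x(1)]) auto
  moreover have "{e \<in> E. fst e \<in> V - set xs \<and> snd e \<in> V - set xs} = E - touching (set xs)"
    using tree_arcs_subset[OF E] by (auto simp: touching_def)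
  moreover have "E - touching (set xs) \<subseteq> (V - set xs) \<times> (V - set xs)"
    using tree_arcs_subset[OF E] by (auto simp: touching_def)
  ultimately show ?thesis
    using trees(1) connected_iff_cut_connected[of "with_proj (digraph_of V E) \<restriction> (V - set xs)"]
    by (simp add: pendant_def subtree_def tree_arcs_cut_connected)
qed

lemma pattern_oriented_star: "oriented_star (digraph_of (set xs) (F xs))"
proof -
  have S: "tree_arcs (set xs) (F xs)"
    by (rule tree[OF pattern(1,2)])
  have "leaf (digraph_of (set xs) (F xs)) v" if "v \<in> set xs" "v \<noteq> hd xs" for v
    using star[OF pattern(1,2)] that by (intro leafI[OF S]) (auto simp: star_def)
  then have "{v \<in> set xs. \<not> leaf (digraph_of (set xs) (F xs)) v} \<subseteq> {hd xs}"
    by blast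
  then have "card {v \<in> set xs. \<not> leaf (digraph_of (set xs) (F xs)) v} \<le> card {hd xs}"
    by (intro card_mono) simp_all
  then show ?thesis
    using S by (simp add: oriented_star_def oriented_tree_iff_tree_arcs)
qed

lemma pattern_leaf:
  assumes "v \<in> set xs" "v \<noteq> hd xs"
  shows "leaf (digraph_of V E) v"
proof -
  obtain x where x: "star_in V E (set xs) (hd xs) x"
    by (rule pattern_star_in)
  show ?thesis
    using assms(1) pattern(3) by (intro leafI[OF E _ star_in_leaf[OF x assms]]) auto
qed

lemma pattern_joined:
  "d \<Longrightarrow> joined_away (digraph_of (set xs) (F xs)) (digraph_of V E)"
  "\<not> d \<Longrightarrow> joined_towards (digraph_of (set xs) (F xs)) (digraph_of V E)"
proof -
  obtain x where x: "E \<inter> touching (set xs) = insert (link d (hd xs) x) (F xs)"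
    "star_in V E (set xs) (hd xs) x"
    by (rule pattern_star_in)
  have "link d (hd xs) x \<in> E" "hd xs \<in> set xs" "x \<in> V - set xs"
    using x(1) star_inD[OF x(2)] by auto
  then show "d \<Longrightarrow> joined_away (digraph_of (set xs) (F xs)) (digraph_of V E)"
    "\<not> d \<Longrightarrow> joined_towards (digraph_of (set xs) (F xs)) (digraph_of V E)"
    unfolding joined_away_def joined_towards_def link_def by auto
qed

end

lemma occ_disjoint:
  assumes "tree_arcs V E" "2 * r < card V" "xs \<in> occ V E" "ys \<in> occ V E" "xs \<noteq> ys"
  shows "set xs \<inter> set ys = {}"
  using occ_pairs[of V E xs ys] assms by (auto simp: tree_arcs_def)

lemma obtain_occ:
  assumes "tree_arcs V E" "2 * r < card V" "s \<le> card (occ V E)"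
  obtains a where "\<And>i. i \<in> {1..s} \<Longrightarrow> a i \<in> occ V E" "disjoint_family_on (\<lambda>i. set (a i)) {1..s :: nat}"
proof -
  have "finite (occ V E)"
    using assms(1) by (intro finite_occ) (simp add: tree_arcs_def)
  then obtain a where a: "inj_on a {1..s}" "a ` {1..s} \<subseteq> occ V E"
    using assms(3) inj_on_iff_card_le[of "{1..s}" "occ V E"] by auto
  have "disjoint_family_on (\<lambda>i. set (a i)) {1..s}"
    unfolding disjoint_family_on_def
  proof (intro ballI impI)
    fix i j assume ij: "i \<in> {1..s}" "j \<in> {1..s}" "i \<noteq> j"
    then have "a i \<noteq> a j"
      using inj_onD[OF a(1)] by blast
    then show "set (a i) \<inter> set (a j) = {}"
      using a(2) ij(1,2) by (intro occ_disjoint[OF assms(1,2)]) auto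
  qed
  then show ?thesis
    using that a(2) by blast
qed

end

section \<open>The two patterns and their disjointness\<close>

definition out_path_arcs :: "'a list \<Rightarrow> ('a \<times> 'a) set" where
  "out_path_arcs xs = {(xs ! 0, xs ! 1)}"

definition in_out_star_arcs :: "'a list \<Rightarrow> ('a \<times> 'a) set" where
  "in_out_star_arcs xs = {(xs ! 1, xs ! 0), (xs ! 0, xs ! 2)}"

lemma length_2E:
  assumes "length xs = 2" obtains u v where "xs = [u, v]"
  using assms by (auto simp: numeral_2_eq_2 length_Suc_conv)

lemma length_3E:
  assumes "length xs = 3" obtains u v w where "xs = [u, v, w]"
  using assms by (auto simp: numeral_3_eq_3 length_Suc_conv)

text \<open>In a star with two vertices either one could be the centre; taking the one attached to
  the rest makes the other a leaf of the whole tree.\<close>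

interpretation A: star_pattern 2 out_path_arcs True
proof
  fix xs :: "'a list" assume xs: "length xs = 2" "distinct xs"
  obtain u v where uv: "xs = [u, v]"
    using xs(1) by (rule length_2E)
  show "star (set xs) (hd xs) (out_path_arcs xs)"
    using xs(2) by (auto simp: uv star_def nbrs_def out_path_arcs_def)
  have "tree_arcs ({v} \<union> {u}) (insert (link True u v) ({} \<union> {}))"
    using xs(2) by (intro tree_arcs_join tree_arcs_singleton) (auto simp: uv)
  then show "tree_arcs (set xs) (out_path_arcs xs)"
    by (simp add: uv out_path_arcs_def link_def insert_commute)
next
  fix xs ys :: "'a list"
  assume "length xs = 2" "length ys = 2" "hd xs = hd ys" "out_path_arcs xs = out_path_arcs ys"
  then show "xs = ys"
    by (auto elim!: length_2E simp: out_path_arcs_def)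
qed

interpretation B: star_pattern 3 in_out_star_arcs False
proof
  fix xs :: "'a list" assume xs: "length xs = 3" "distinct xs"
  obtain u v w where uvw: "xs = [u, v, w]"
    using xs(1) by (rule length_3E)
  show "star (set xs) (hd xs) (in_out_star_arcs xs)"
    using xs(2) by (auto simp: uvw star_def nbrs_def in_out_star_arcs_def)
  have "tree_arcs ({u} \<union> {v}) (insert (link True v u) ({} \<union> {}))"
    using xs(2) by (intro tree_arcs_join tree_arcs_singleton) (auto simp: uvw)
  then have "tree_arcs (({u} \<union> {v}) \<union> {w}) (insert (link False w u) (insert (link True v u) ({} \<union> {}) \<union> {}))"
    using xs(2) by (intro tree_arcs_join tree_arcs_singleton) (auto simp: uvw)
  moreover have "({u} \<union> {v}) \<union> {w} = set xs"
    by (auto simp: uvw)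
  moreover have "insert (link False w u) (insert (link True v u) ({} \<union> {}) \<union> {}) = in_out_star_arcs xs"
    by (auto simp: uvw in_out_star_arcs_def link_def)
  ultimately show "tree_arcs (set xs) (in_out_star_arcs xs)"
    by simp
next
  fix xs ys :: "'a list"
  assume "length xs = 3" "length ys = 3" "distinct xs" "distinct ys" "hd xs = hd ys"
    "in_out_star_arcs xs = in_out_star_arcs ys"
  \<comment> \<open>The two leaves have different roles, one arc entering the centre and one leaving
    it, so they cannot be exchanged.\<close>
  then show "xs = ys"
    by (auto elim!: length_3E simp: in_out_star_arcs_def doubleton_eq_iff)
qed

text \<open>Stars with the same centre would coincide, but the sizes 2 and 3 differ. The bound 5 is
  the sum of the sizes.\<close>

lemma A_B_disjoint:
  assumes "tree_arcs V E" "5 < card V" "xs \<in> A.occ V E" "ys \<in> B.occ V E"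
  shows "set xs \<inter> set ys = {}"
proof -
  have cc: "cut_connected V E"
    by (rule tree_arcs_cut_connected[OF assms(1)])
  obtain x where x: "star_in V E (set xs) (hd xs) x"
    by (rule A.pattern_star_in[OF assms(1,3)])
  obtain y where y: "star_in V E (set ys) (hd ys) y"
    by (rule B.pattern_star_in[OF assms(1,4)])
  have card: "card (set xs) = 2" "card (set ys) = 3"
    using A.pattern[OF assms(1,3)] B.pattern[OF assms(1,4)] by (simp_all add: distinct_card)
  then have "hd xs \<noteq> hd ys"
    using star_in_same_centre[OF cc x] y assms(2) by fastforce
  then show ?thesis
    using star_in_distinct_centres(1)[OF cc x y] card assms(2) by simp
qed

lemma niceI:
  assumes E: "tree_arcs V E" and "6 < card V"
    and s: "nat \<lceil>\<alpha> * real (card V)\<rceil> \<le> card (A.occ V E)" "nat \<lceil>\<alpha> * real (card V)\<rceil> \<le> card (B.occ V E)"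
  shows "nice \<alpha> (digraph_of V E)"
proof -
  define s where "s = nat \<lceil>\<alpha> * real (card V)\<rceil>"
  obtain a where a: "\<And>i. i \<in> {1..s} \<Longrightarrow> a i \<in> A.occ V E" "disjoint_family_on (\<lambda>i. set (a i)) {1..s}"
    using A.obtain_occ[OF E _ s(1)[folded s_def]] assms(2) by auto
  obtain b where b: "\<And>i. i \<in> {1..s} \<Longrightarrow> b i \<in> B.occ V E" "disjoint_family_on (\<lambda>i. set (b i)) {1..s}"
    using B.obtain_occ[OF E _ s(2)[folded s_def]] assms(2) by auto
  define A' where "A' = (\<lambda>i. digraph_of (set (a i)) (out_path_arcs (a i)))"
  define B' where "B' = (\<lambda>i. digraph_of (set (b i)) (in_out_star_arcs (b i)))"
  have A': "pendant (A' i) (digraph_of V E) \<and> oriented_star (A' i) \<and>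
      (\<exists>v\<in>pverts (A' i). out_leaf (digraph_of V E) v) \<and> joined_away (A' i) (digraph_of V E)"
    if "i \<in> {1..s}" for i
  proof -
    note ai = a(1)[OF that]
    obtain u v where uv: "a i = [u, v]"
      using A.pattern(1)[OF E ai] by (rule length_2E)
    have "u \<noteq> v"
      using A.pattern(2)[OF E ai] uv by simp
    then have "leaf (digraph_of V E) v"
      using A.pattern_leaf[OF E ai, of v] by (simp add: uv)
    moreover have "(u, v) \<in> E"
      using A.pattern_arcs[OF E ai] by (simp add: uv out_path_arcs_def)
    ultimately have "out_leaf (digraph_of V E) v"
      by (auto simp: out_leaf_def)
    then show ?thesis
      unfolding A'_def using A.pattern_pendant[OF E ai] A.pattern_oriented_star[OF E ai] A.pattern_joined(1)[OF E ai]
      by (auto simp: uv)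
  qed
  have B': "pendant (B' i) (digraph_of V E) \<and> oriented_star (B' i) \<and>
      (\<exists>v\<in>pverts (B' i). in_leaf (digraph_of V E) v) \<and> (\<exists>v\<in>pverts (B' i). out_leaf (digraph_of V E) v) \<and>
      joined_towards (B' i) (digraph_of V E)"
    if "i \<in> {1..s}" for i
  proof -
    note bi = b(1)[OF that]
    obtain u v w where uvw: "b i = [u, v, w]"
      using B.pattern(1)[OF E bi] by (rule length_3E)
    have "u \<noteq> v" "u \<noteq> w"
      using B.pattern(2)[OF E bi] uvw by auto
    then have "leaf (digraph_of V E) v" "leaf (digraph_of V E) w"
      using B.pattern_leaf[OF E bi, of v] B.pattern_leaf[OF E bi, of w] by (simp_all add: uvw)
    moreover have "(v, u) \<in> E" "(u, w) \<in> E"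
      using B.pattern_arcs[OF E bi] by (simp_all add: uvw in_out_star_arcs_def)
    ultimately have "in_leaf (digraph_of V E) v" "out_leaf (digraph_of V E) w"
      by (auto simp: in_leaf_def out_leaf_def)
    then show ?thesis
      unfolding B'_def using B.pattern_pendant[OF E bi] B.pattern_oriented_star[OF E bi] B.pattern_joined(2)[OF E bi]
      by (auto simp: uvw)
  qed
  have AB: "pverts (A' i) \<inter> pverts (B' j) = {}" if "i \<in> {1..s}" "j \<in> {1..s}" for i j
    using A_B_disjoint[OF E _ a(1)[OF that(1)] b(1)[OF that(2)]] assms(2) by (simp add: A'_def B'_def)
  have disj: "disjoint_family_on (\<lambda>i. pverts (A' i)) {1..s}" "disjoint_family_on (\<lambda>i. pverts (B' i)) {1..s}"
    using a(2) b(2) by (simp_all add: A'_def B'_def)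
  have s_eq: "nat \<lceil>\<alpha> * real (card (pverts (digraph_of V E)))\<rceil> = s"
    by (simp add: s_def)
  have T: "oriented_tree (digraph_of V E)"
    using E by (simp add: oriented_tree_iff_tree_arcs)
  show ?thesis
    unfolding nice_def Let_def s_eq
  proof (rule conjI[OF T], rule exI[of _ A'], rule exI[of _ B'], intro conjI)
    show "\<forall>i\<in>{1..s}. \<forall>j\<in>{1..s}. pverts (A' i) \<inter> pverts (B' j) = {}"
      by (intro ballI AB)
    show "\<forall>i\<in>{1..s}. pendant (A' i) (digraph_of V E) \<and> oriented_star (A' i) \<and>
      (\<exists>v\<in>pverts (A' i). out_leaf (digraph_of V E) v) \<and> joined_away (A' i) (digraph_of V E)"
      by (intro ballI A')
    show "\<forall>i\<in>{1..s}. pendant (B' i) (digraph_of V E) \<and> oriented_star (B' i) \<and>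
      (\<exists>v\<in>pverts (B' i). in_leaf (digraph_of V E) v) \<and> (\<exists>v\<in>pverts (B' i). out_leaf (digraph_of V E) v) \<and>
      joined_towards (B' i) (digraph_of V E)"
      by (intro ballI B')
  qed (rule disj)+
qed

lemma labelled_oriented_trees_eq: "labelled_oriented_trees n = digraph_of {1..n} ` trees {1..n}"
proof (rule set_eqI)
  fix T :: "nat pair_pre_digraph"
  show "T \<in> labelled_oriented_trees n \<longleftrightarrow> T \<in> digraph_of {1..n} ` trees {1..n}"
    by (cases T) (auto simp: labelled_oriented_trees_def oriented_tree_iff_tree_arcs trees_def)
qed

text \<open>A union bound: the trees with too few occurrences of one of the patterns are discarded,
  and all others are nice.\<close>

lemma prob_nice_lower_bound:
  assumes n: "n > 1900"
  shows "1 - (card {E \<in> trees {1..n}. real (card (A.occ {1..n} E)) \<le> 1/220 * n} / card (trees {1..n}) +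
      card {E \<in> trees {1..n}. real (card (B.occ {1..n} E)) \<le> 1/220 * n} / card (trees {1..n})) \<le>
    measure_pmf.prob (pmf_of_set (labelled_oriented_trees n)) {T. nice (1/250) T}"
proof -
  define Ts where "Ts = trees {1..n}"
  define P Q where "P = {E \<in> Ts. real (card (A.occ {1..n} E)) \<le> 1/220 * n}"
    and "Q = {E \<in> Ts. real (card (B.occ {1..n} E)) \<le> 1/220 * n}"
  define N where "N = {E \<in> Ts. nice (1/250) (digraph_of {1..n} E)}"
  have fin: "finite Ts"
    by (simp add: Ts_def finite_trees)
  have "card Ts > 0"
    using n by (simp add: Ts_def card_trees)
  have inj: "inj_on (digraph_of {1..n}) X" for X
    by (auto simp: inj_on_def)
  have "Ts - (P \<union> Q) \<subseteq> N"
  proof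
    fix E assume E: "E \<in> Ts - (P \<union> Q)"
    have "of_int \<lceil>1/250 * real n\<rceil> \<le> 1/250 * real n + 1"
      by (rule of_int_ceiling_le_add_one)
    \<comment> \<open>Rounding up costs at most 1, and \<open>1/220 - 1/250 = 3/5500\<close> makes
      up for it from \<open>n = 1834\<close> on; 1900 is a convenient bound.\<close>
    moreover have "1/250 * real n + 1 \<le> 1/220 * real n"
      using n by simp
    moreover have "1/220 * real n < card (A.occ {1..n} E)" "1/220 * real n < card (B.occ {1..n} E)"
      using E by (auto simp: P_def Q_def)
    ultimately have "nat \<lceil>1/250 * real n\<rceil> \<le> card (A.occ {1..n} E)" "nat \<lceil>1/250 * real n\<rceil> \<le> card (B.occ {1..n} E)"
      by linarith+
    moreover have "tree_arcs {1..n} E"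
      using E by (simp add: Ts_def trees_def)
    ultimately have "nice (1/250) (digraph_of {1..n} E)"
      using n by (intro niceI) simp_all
    then show "E \<in> N"
      using E by (simp add: N_def)
  qed
  then have "card (Ts - (P \<union> Q)) \<le> card N"
    by (rule card_mono[rotated]) (simp add: N_def fin)
  moreover have "card Ts \<le> card (Ts - (P \<union> Q)) + card (P \<union> Q)"
    by (simp add: le_diff_conv[symmetric] diff_card_le_card_Diff P_def Q_def fin)
  moreover have "card (P \<union> Q) \<le> card P + card Q"
    by (rule card_Un_le)
  ultimately have "card Ts \<le> card N + (card P + card Q)"
    by linarith
  then have "real (card Ts) - (real (card P) + real (card Q)) \<le> card N"
    by linarith
  then have "(real (card Ts) - (real (card P) + real (card Q))) / card Ts \<le> card N / card Ts"
    by (rule divide_right_mono) simp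
  then have "1 - (card P / card Ts + card Q / card Ts) \<le> card N / card Ts"
    using \<open>card Ts > 0\<close> by (simp add: diff_divide_distrib add_divide_distrib)
  also have "card N / card Ts = measure_pmf.prob (pmf_of_set (labelled_oriented_trees n)) {T. nice (1/250) T}"
  proof -
    have "labelled_oriented_trees n \<inter> {T. nice (1/250) T} = digraph_of {1..n} ` N"
      by (auto simp: labelled_oriented_trees_eq N_def Ts_def)
    moreover have "labelled_oriented_trees n \<noteq> {}"
      using n by (intro labelled_oriented_trees_nonempty) simp
    ultimately have "measure_pmf.prob (pmf_of_set (labelled_oriented_trees n)) {T. nice (1/250) T} =
      card (digraph_of {1..n} ` N) / card (labelled_oriented_trees n)"
      by (simp add: measure_pmf_of_set finite_labelled_oriented_trees)
    moreover have "card (digraph_of {1..n} ` N) = card N" "card (labelled_oriented_trees n) = card Ts"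
      unfolding labelled_oriented_trees_eq Ts_def by (rule card_image[OF inj])+
    ultimately show ?thesis
      by simp
  qed
  finally show ?thesis
    by (simp add: P_def Q_def Ts_def)
qed

theorem theorem1p6:
  shows "(\<lambda>n. measure_pmf.prob (pmf_of_set (labelled_oriented_trees n))
                {T. nice (1/250) T}) \<longlonglongrightarrow> 1"
proof -
  \<comment> \<open>This estimate suffices: it gives \<open>exp 2 \<le> 9\<close> and
    \<open>exp 3 \<le> 27\<close>, and \<open>4 * 9 = 36\<close> and \<open>8 * 27 = 216\<close> are
    both below 220.\<close>
  have e: "exp (1 :: real) \<le> 3"
    by (rule exp_le)
  have "exp (2 :: real) = exp 1 ^ 2" "exp (3 :: real) = exp 1 ^ 3"
    by (simp_all add: exp_of_nat_mult[symmetric])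
  moreover have "exp (1 :: real) ^ 2 \<le> 3 ^ 2" "exp (1 :: real) ^ 3 \<le> 3 ^ 3"
    using e by (intro power_mono; simp)+
  ultimately have "exp (2 :: real) \<le> 9" "exp (3 :: real) \<le> 27"
    by simp_all
  then have c: "1/220 < exp (-2 :: real) / 4" "1/220 < exp (-3 :: real) / 8"
    by (simp_all add: exp_minus field_simps)
  have "(\<lambda>n. card {E \<in> trees {1..n}. real (card (A.occ {1..n} E)) \<le> 1/220 * n} / card (trees {1..n})) \<longlonglongrightarrow> 0"
    by (rule A.few_occ[OF _ _ c(1)]) (use ntrees_limits in \<open>simp_all add: A.mean_def A.pair_mean_def\<close>)
  moreover have "(\<lambda>n. card {E \<in> trees {1..n}. real (card (B.occ {1..n} E)) \<le> 1/220 * n} / card (trees {1..n})) \<longlonglongrightarrow> 0"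
    by (rule B.few_occ[OF _ _ c(2)]) (use ntrees_limits in \<open>simp_all add: B.mean_def B.pair_mean_def\<close>)
  ultimately have lim: "(\<lambda>n. 1 - (card {E \<in> trees {1..n}. real (card (A.occ {1..n} E)) \<le> 1/220 * n} / card (trees {1..n}) +
      card {E \<in> trees {1..n}. real (card (B.occ {1..n} E)) \<le> 1/220 * n} / card (trees {1..n}))) \<longlonglongrightarrow> 1 - (0 + 0)"
    by (intro tendsto_diff tendsto_add tendsto_const)
  show ?thesis
  proof (rule tendsto_sandwich[OF _ _ _ tendsto_const])
    show "eventually (\<lambda>n. 1 - (card {E \<in> trees {1..n}. real (card (A.occ {1..n} E)) \<le> 1/220 * n} / card (trees {1..n}) +
        card {E \<in> trees {1..n}. real (card (B.occ {1..n} E)) \<le> 1/220 * n} / card (trees {1..n})) \<le>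
      measure_pmf.prob (pmf_of_set (labelled_oriented_trees n)) {T. nice (1/250) T}) sequentially"
      using eventually_gt_at_top[of 1900] by eventually_elim (rule prob_nice_lower_bound)
  qed (use lim in simp_all)
qed

end
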